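(* Let $(a_0(n))_n$ and $(a_1(n))_n$ be real sequences with $2a_0(n)+a_1(n)=1$ for all $n$, and let $U_n^{M,1}$ be the associated modified genuine Bernstein-Durrmeyer operators. Suppose $f\in C^2[0,1]$ and that the (finite) limit $L_1=\lim_{n\to\infty}a_1(n)$ exists. Then for every $x\in[0,1]$ and every integer $n\ge1$, \begin{align*} &\left|n\left[U_n^{M,1}(f;x)-f(x)\right]-x(1-x)f''(x)-\frac{1-2x}2(1+L_1)f'(x)\right|\\ &\le\frac{5\sqrt6}{12}\,\omega_1\!\left(f'';\sqrt{\frac3{n+2}}\right)+\frac{13}{32}\,\omega_2\!\left(f'';\sqrt{\frac3{n+2}}\right)+\frac98\,\omega_2\!\left(f;\sqrt{\frac2{n+1}}\right)\\ &\quad+\frac12\left\{|L_1-a_1(n)|\,\|f'\|_\infty+|1+L_1|\left[\frac1{\sqrt{n+1}}\,\omega_1\!\left(f';\frac1{\sqrt{n+1}}\right)+\frac54\,\omega_2\!\left(f';\frac1{\sqrt{n+1}}\right)\right]\right\}. \end{align*}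
   Context: Bernstein basis: $p_{n,k}(x)=\binom nk x^k(1-x)^{n-k}$ for $0\le k\le n$, $x\in[0,1]$ (with $0^0=1$), and $p_{n,k}=0$ if $k<0$ or $k>n$. Modified basis: given real sequences $a_0(n),a_1(n)$, put $a(x,n)=a_1(n)x+a_0(n)$ and, for $0\le k\le n$, $$p_{n,k}^{M,1}(x)=a(x,n)\,p_{n-1,k}(x)+a(1-x,n)\,p_{n-1,k-1}(x).$$ Modified genuine Bernstein-Durrmeyer operator: $$U_n^{M,1}(f;x)=a(x,n)(1-x)^{n-1}f(0)+a(1-x,n)x^{n-1}f(1)+(n-1)\sum_{k=1}^{n-1}p_{n,k}^{M,1}(x)\int_0^1p_{n-2,k-1}(t)f(t)\,dt$$ (for $n=1$ the sum is empty). No positivity is assumed. Moduli, for $g\in C[0,1]$ and $\delta>0$: $\omega_1(g;\delta)=\sup\{|g(s)-g(t)|: s,t\in[0,1],\ |s-t|\le\delta\}$ and $\omega_2(g;\delta)=\sup\{|g(t-h)-2g(t)+g(t+h)|: 0\le h\le\delta,\ t\pm h\in[0,1]\}$. $\|\cdot\|_\infty$ is the sup norm on $[0,1]$. *)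

theory Defs
  imports "HOL-Analysis.Analysis"
begin

text \<open>
  The library's \<^const>\<open>Bernstein\<close> has a natural-number second index and already vanishes for
  \<open>k > n\<close>, through the binomial coefficient. Integer indices are needed because the modified
  basis refers to \<open>p\<^sub>n\<^sub>-\<^sub>1\<^sub>,\<^sub>k\<^sub>-\<^sub>1\<close> also for \<open>k = 0\<close>.
\<close>
definition bern_basis :: "nat \<Rightarrow> int \<Rightarrow> real \<Rightarrow> real" where
  "bern_basis n k x = (if k < 0 then 0 else Bernstein n (nat k) x)"

definition afun :: "(nat \<Rightarrow> real) \<Rightarrow> (nat \<Rightarrow> real) \<Rightarrow> real \<Rightarrow> nat \<Rightarrow> real" where
  "afun a0 a1 x n = a1 n * x + a0 n"

text \<open>Both definitions below are meant for \<open>n \<ge> 1\<close>, where \<open>n - 1\<close> does not truncate. The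
  degree \<open>n - 2\<close> is used only when the sum is nonempty, that is for \<open>n \<ge> 2\<close>.\<close>
definition mod_basis ::
    "(nat \<Rightarrow> real) \<Rightarrow> (nat \<Rightarrow> real) \<Rightarrow> nat \<Rightarrow> nat \<Rightarrow> real \<Rightarrow> real" where
  "mod_basis a0 a1 n k x =
     afun a0 a1 x n * bern_basis (n - 1) (int k) x +
     afun a0 a1 (1 - x) n * bern_basis (n - 1) (int k - 1) x"

definition mod_genuine_BD ::
    "(nat \<Rightarrow> real) \<Rightarrow> (nat \<Rightarrow> real) \<Rightarrow> nat \<Rightarrow> (real \<Rightarrow> real) \<Rightarrow> real \<Rightarrow> real" where
  "mod_genuine_BD a0 a1 n f x =
     afun a0 a1 x n * (1 - x) ^ (n - 1) * f 0 +
     afun a0 a1 (1 - x) n * x ^ (n - 1) * f 1 +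
     (real n - 1) *
       (\<Sum>k = 1..n - 1. mod_basis a0 a1 n k x *
          integral {0..1} (\<lambda>t. bern_basis (n - 2) (int k - 1) t * f t))"

text \<open>The suprema below are real-valued, hence meaningful for functions bounded on \<open>[0,1]\<close>,
  in particular for continuous ones.\<close>
definition modulus1 :: "(real \<Rightarrow> real) \<Rightarrow> real \<Rightarrow> real" where
  "modulus1 g \<delta> =
     Sup {\<bar>g s - g t\<bar> | s t. s \<in> {0..1} \<and> t \<in> {0..1} \<and> \<bar>s - t\<bar> \<le> \<delta>}"

definition modulus2 :: "(real \<Rightarrow> real) \<Rightarrow> real \<Rightarrow> real" where
  "modulus2 g \<delta> =
     Sup {\<bar>g (t - h) - 2 * g t + g (t + h)\<bar> | t h.
            0 \<le> h \<and> h \<le> \<delta> \<and> t - h \<in> {0..1} \<and> t + h \<in> {0..1}}"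

definition sup_norm01 :: "(real \<Rightarrow> real) \<Rightarrow> real" where
  "sup_norm01 g = (SUP x\<in>{0..1}. \<bar>g x\<bar>)"

end

theory Submission
  imports Defs
begin

text \<open>
  Write \<open>a(x,n) = (1 - x) + (1 + a\<^sub>1(n)) (x - 1/2)\<close>. This splits the modified operator into the genuine
  Bernstein-Durrmeyer operator \<open>U\<^sub>n\<close> and a multiple of its derivative, and
  \<open>(U\<^sub>n f)' = M\<^sub>n\<^sub>-\<^sub>1 f'\<close> with the classical Durrmeyer operator \<open>M\<^sub>n\<^sub>-\<^sub>1\<close>:
  \<open>n U\<^sub>n\<^sup>M f = n U\<^sub>n f + (1 - 2x)/2 (1 + a\<^sub>1(n)) M\<^sub>n\<^sub>-\<^sub>1 f'\<close>. For \<open>U\<^sub>n\<close> a Taylor expansion and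
  the moments of order 2 and 4 leave ample room in the constants; the defect
  \<open>x(1 - x) f''(x) / (n + 1)\<close> is absorbed by \<open>\<omega>\<^sub>2(f)\<close>. For \<open>M\<^sub>n\<^sub>-\<^sub>1\<close> the constants are those of
  Paltanea's estimate
  \<open>\<bar>L g - g x\<bar> \<le> \<bar>L e\<^sub>1 - x\<bar> / h \<omega>\<^sub>1(g;h) + (1 + L (e\<^sub>1 - x)\<^sup>2 / (2h\<^sup>2)) \<omega>\<^sub>2(g;h)\<close>
  for positive functionals; it is valid for \<open>h \<le> 1/2\<close> only, so the cases \<open>n = 1, 2\<close> need extra care.
\<close>

section \<open>Bounds on increments through second differences\<close>

text \<open>Maximum principle: at the leftmost maximum of the difference of the two sides, the largest
  admissible second difference gives a contradiction.\<close>
lemma chord_bound: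
  fixes g :: "real \<Rightarrow> real"
  assumes cont: "continuous_on {s..t} g" and eta: "\<eta> > 0" and B: "B \<ge> 0"
    and diff2: "\<And>y d. 0 \<le> d \<Longrightarrow> d \<le> \<eta> \<Longrightarrow> s \<le> y - d \<Longrightarrow> y + d \<le> t \<Longrightarrow>
                  g (y - d) - 2 * g y + g (y + d) \<le> B"
    and kappa: "t - s \<le> 2 * \<eta> \<or> 1 \<le> 2 * \<kappa> * \<eta>\<^sup>2" "\<kappa> \<ge> 0"
    and y: "s \<le> y" "y \<le> t"
  shows "(t - y) * g s + (y - s) * g t - (t - s) * g y
           \<le> (t - s) * (B * (1 + \<kappa> * (t - y) * (y - s)))"
proof (cases "s = t")
  case True
  then show ?thesis using y by simp
next
  case False
  with y have st: "s < t" by simp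
  define m where "m = (g t - g s) / (t - s)"
  \<comment> \<open>The chord of \<open>g\<close> minus \<open>g\<close> minus the claimed bound, so
    the goal is \<open>E y \<le> 0\<close>. Both ends give \<open>- B\<close>.\<close>
  define E where "E z = g s + m * (z - s) - g z - B * (1 + \<kappa> * (t - z) * (z - s))" for z
  have Es: "E s = - B" by (simp add: E_def)
  have Et: "E t = - B" using st by (simp add: E_def m_def)
  have contE: "continuous_on {s..t} E"
    unfolding E_def by (intro continuous_intros cont)
  have "E y \<le> 0"
  proof (rule ccontr)
    assume "\<not> E y \<le> 0"
    obtain z where z: "z \<in> {s..t}" "\<And>w. w \<in> {s..t} \<Longrightarrow> E w \<le> E z"
      using continuous_attains_sup[OF _ _ contE] st by auto
    define M where "M = E z"
    have M: "M > 0" using z(2)[of y] y \<open>\<not> E y \<le> 0\<close> by (simp add: M_def)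
    have "closed ({s..t} \<inter> E -` {M})"
      by (rule continuous_closed_preimage[OF contE]) auto
    then have "compact ({s..t} \<inter> ({s..t} \<inter> E -` {M}))"
      using compact_Int_closed compact_Icc by blast
    then have "compact ({s..t} \<inter> E -` {M})" by (simp add: Int_absorb1 flip: Int_assoc)
    moreover have "{s..t} \<inter> E -` {M} \<noteq> {}" using z by (auto simp: M_def)
    ultimately obtain w where w: "w \<in> {s..t} \<inter> E -` {M}"
      "\<And>v. v \<in> {s..t} \<inter> E -` {M} \<Longrightarrow> w \<le> v"
      using compact_attains_inf by metis
    have "E w = M" using w by auto
    have "w \<noteq> s" "w \<noteq> t" using Es Et M B \<open>E w = M\<close> by auto
    then have sw: "s < w" "w < t" using w by auto
    \<comment> \<open>The largest step that is at most \<open>\<eta>\<close> and stays in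
      \<open>{s..t}\<close>. So either an endpoint is reached, where the value \<open>- B\<close>
      cancels the \<open>+ B\<close> of \<open>key\<close>, or \<open>d = \<eta>\<close> with both
      points interior.\<close>
    define d where "d = min \<eta> (min (w - s) (t - w))"
    have d: "d > 0" "d \<le> \<eta>" "s \<le> w - d" "w + d \<le> t" using sw eta by (auto simp: d_def)
    have g2: "g (w - d) - 2 * g w + g (w + d) \<le> B"
      using diff2 d by simp
    have "E (w - d) + E (w + d) - 2 * E w =
        - (g (w - d) - 2 * g w + g (w + d)) + 2 * B * \<kappa> * d\<^sup>2"
      unfolding E_def by (simp add: algebra_simps power2_eq_square)
    then have key: "2 * M \<le> E (w - d) + E (w + d) + B - 2 * B * \<kappa> * d\<^sup>2"
      using g2 \<open>E w = M\<close> by simp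
    have k0: "2 * B * \<kappa> * d\<^sup>2 \<ge> 0" using B kappa by simp
    have le: "E (w - d) \<le> M" "E (w + d) \<le> M"
      using z(2) d sw by (auto simp: M_def)
    consider "w - d = s" | "w + d = t" | "d = \<eta>" "s < w - d" "w + d < t"
      using d unfolding d_def by linarith
    then show False
    proof cases
      case 1
      then show False using key k0 le Es M by simp
    next
      case 2
      then show False using key k0 le Et M by simp
    next
      case 3
      \<comment> \<open>Interior points on both sides force \<open>t - s > 2 * \<eta>\<close>, so
        the second alternative of \<open>kappa\<close> holds. The quadratic term then outweighs
        \<open>B\<close>, and \<open>w - d\<close> is a maximum point left of
        \<open>w\<close>.\<close>
      then have "1 \<le> 2 * \<kappa> * d\<^sup>2" using kappa(1) by auto
      from mult_left_mono[OF this B] have "E (w - d) \<ge> M"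
        using key le by (simp add: algebra_simps)
      then have "w - d \<in> {s..t} \<inter> E -` {M}" using le d sw by auto
      then show False using w(2)[of "w - d"] d by simp
    qed
  qed
  then have "(t - s) * E y \<le> 0" using st by (simp add: mult_nonneg_nonpos)
  moreover have "(t - s) * E y = (t - y) * g s + (y - s) * g t - (t - s) * g y
     - (t - s) * (B * (1 + \<kappa> * (t - y) * (y - s)))"
  proof -
    have "(t - s) * (m * (y - s)) = (g t - g s) * (y - s)" using st by (simp add: m_def)
    then show ?thesis unfolding E_def by (simp add: algebra_simps)
  qed
  ultimately show ?thesis by simp
qed

lemma telescoped_increment:
  fixes g :: "real \<Rightarrow> real"
  assumes W: "\<And>p q. p \<in> {0..1} \<Longrightarrow> q \<in> {0..1} \<Longrightarrow> \<bar>p - q\<bar> \<le> h \<Longrightarrow> \<bar>g p - g q\<bar> \<le> W"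
    and "p \<in> {0..1}" "p + real k * h \<in> {0..1}" and "h \<ge> 0"
  shows "\<bar>g (p + real k * h) - g p\<bar> \<le> real k * W"
  using assms(3)
proof (induction k)
  case (Suc k)
  have "p + real k * h \<le> p + real (Suc k) * h" using \<open>h \<ge> 0\<close> by (simp add: algebra_simps)
  then have in01: "p + real k * h \<in> {0..1}"
    using Suc.prems assms(2) \<open>h \<ge> 0\<close> by auto
  have "\<bar>g (p + real (Suc k) * h) - g (p + real k * h)\<bar> \<le> W"
    using W Suc.prems in01 \<open>h \<ge> 0\<close> by (simp add: algebra_simps)
  then show ?case using Suc.IH[OF in01] by (simp add: algebra_simps)
qed simp

text \<open>With \<open>v = \<bar>p - q\<bar> / h\<close> and \<open>k\<close> its integer part,
  \<open>k\<close> steps of length \<open>h\<close> and a remainder cost \<open>(k + 1) * W\<close>,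
  and \<open>k \<le> k * k \<le> v * v\<close> for an integer \<open>k\<close>.\<close>

lemma increment_le_square:
  fixes g :: "real \<Rightarrow> real"
  assumes W: "\<And>p q. p \<in> {0..1} \<Longrightarrow> q \<in> {0..1} \<Longrightarrow> \<bar>p - q\<bar> \<le> h \<Longrightarrow> \<bar>g p - g q\<bar> \<le> W"
    and pq: "p \<in> {0..1}" "q \<in> {0..1}" and "h > 0"
  shows "\<bar>g p - g q\<bar> \<le> (1 + (p - q)\<^sup>2 / h\<^sup>2) * W"
proof -
  have *: "\<bar>g q - g p\<bar> \<le> (1 + (q - p)\<^sup>2 / h\<^sup>2) * W"
    if "p \<in> {0..1}" "q \<in> {0..1}" "p \<le> q" for p q
  proof -
    define v where "v = (q - p) / h"
    define k where "k = nat \<lfloor>v\<rfloor>"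
    have v: "v \<ge> 0" "q = p + v * h" using that \<open>h > 0\<close> by (auto simp: v_def)
    have k: "real k \<le> v" "v < real k + 1" using v by (auto simp: k_def)
    have W0: "W \<ge> 0" using W[of 0 0] \<open>h > 0\<close> by simp
    have kh: "real k * h \<le> v * h" using k \<open>h > 0\<close> by (simp add: mult_right_mono)
    have kh2: "v * h \<le> (real k + 1) * h" using k \<open>h > 0\<close> by (simp add: mult_right_mono)
    have "0 \<le> real k * h" using \<open>h > 0\<close> by simp
    then have mid: "p + real k * h \<in> {0..1}"
      using kh v(2) that unfolding atLeastAtMost_iff by linarith
    have 1: "\<bar>g (p + real k * h) - g p\<bar> \<le> real k * W"
      by (rule telescoped_increment[OF W]) (use that mid \<open>h > 0\<close> in auto)
    have 2: "\<bar>g q - g (p + real k * h)\<bar> \<le> W"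
      by (rule W) (use that mid kh kh2 v in \<open>auto simp: algebra_simps\<close>)
    show ?thesis
    proof (cases "k = 0")
      case True
      have "W \<le> (1 + (q - p)\<^sup>2 / h\<^sup>2) * W" using W0 by (simp add: algebra_simps)
      then show ?thesis using 2 True by simp
    next
      case False
      then have "real k \<le> real k * real k" by (simp add: mult_le_cancel_left1)
      also have "\<dots> \<le> v * v" using k by (intro mult_mono) auto
      also have "\<dots> = (q - p)\<^sup>2 / h\<^sup>2" by (simp add: v_def power2_eq_square)
      finally have "(1 + real k) * W \<le> (1 + (q - p)\<^sup>2 / h\<^sup>2) * W"
        using W0 by (intro mult_right_mono) auto
      then show ?thesis using 1 2 by (simp add: algebra_simps)
    qed
  qed
  show ?thesis
    using *[of p q] *[of q p] pq by (cases "p \<le> q") (auto simp: abs_minus_commute power2_commute)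
qed

text \<open>For \<open>q - p \<le> h\<close>, interpolate \<open>g\<close> linearly on an interval
  of length exactly \<open>h\<close> starting at \<open>p\<close> or ending at \<open>q\<close>;
  \<open>room\<close> says that one of them fits. The slope of the chord costs \<open>W / h\<close>,
  the deviation from the chord costs \<open>B\<close>. Longer increments first lose whole steps of
  length \<open>h\<close>.\<close>

lemma increment_le_linear:
  fixes g :: "real \<Rightarrow> real"
  assumes cont: "continuous_on {0..1} g" and eta: "\<eta> > 0" and B: "B \<ge> 0"
    and diff2: "\<And>y d. 0 \<le> d \<Longrightarrow> d \<le> \<eta> \<Longrightarrow> 0 \<le> y - d \<Longrightarrow> y + d \<le> 1 \<Longrightarrow>
                  \<bar>g (y - d) - 2 * g y + g (y + d)\<bar> \<le> B"
    and W: "\<And>p q. p \<in> {0..1} \<Longrightarrow> q \<in> {0..1} \<Longrightarrow> \<bar>p - q\<bar> \<le> h \<Longrightarrow> \<bar>g p - g q\<bar> \<le> W"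
    and h: "0 < h" "h \<le> 2 * \<eta>"
    and pq: "0 \<le> p" "p \<le> q" "q \<le> 1"
    and room: "p + h \<le> 1 \<or> h \<le> q"
  shows "\<bar>g q - g p\<bar> \<le> (q - p) / h * W + B"
proof -
  have short: "\<bar>g q - g p\<bar> \<le> (q - p) / h * W + B"
    if pq: "0 \<le> p" "p \<le> q" "q \<le> 1" "q - p \<le> h" and room: "p + h \<le> 1 \<or> h \<le> q" for p q
  proof -
    \<comment> \<open>Because \<open>h \<le> 2 * \<eta>\<close>, the chord bound is available with
      \<open>\<kappa> = 0\<close>; using it for \<open>g\<close> and \<open>- g\<close> gives both
      signs.\<close>
    have ch: "\<bar>(b - y) * g a + (y - a) * g b - h * g y\<bar> \<le> h * B"
      if "0 \<le> a" "b \<le> 1" "b = a + h" "a \<le> y" "y \<le> b" for a b y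
    proof -
      have "continuous_on {a..b} g" using cont by (rule continuous_on_subset) (use that in auto)
      moreover have "continuous_on {a..b} (\<lambda>t. - g t)" using calculation by (intro continuous_intros)
      moreover have "\<bar>g (y - d) - 2 * g y + g (y + d)\<bar> \<le> B"
        if "0 \<le> d" "d \<le> \<eta>" "a \<le> y - d" "y + d \<le> b" for y d
        by (rule diff2) (use that \<open>0 \<le> a\<close> \<open>b \<le> 1\<close> in auto)
      ultimately show ?thesis
        using chord_bound[of a b g \<eta> B 0 y] chord_bound[of a b "\<lambda>t. - g t" \<eta> B 0 y] eta B h that
        by (fastforce simp: abs_le_iff)
    qed
    have "\<bar>h * (g q - g p)\<bar> \<le> (q - p) * W + h * B"
    proof (cases "p + h \<le> 1")
      case True
      have e: "h * (g q - g p) = (q - p) * (g (p + h) - g p)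
          - ((p + h - q) * g p + (q - p) * g (p + h) - h * g q)"
        by (simp add: algebra_simps)
      have "\<bar>g (p + h) - g p\<bar> \<le> W" using W True pq h by auto
      then have "\<bar>(q - p) * (g (p + h) - g p)\<bar> \<le> (q - p) * W"
        using pq by (simp add: abs_mult mult_left_mono)
      then show ?thesis using e ch[of p "p + h" q] True pq by linarith
    next
      case False
      then have "h \<le> q" using room by simp
      have e: "h * (g q - g p) = (q - p) * (g q - g (q - h))
          + ((q - p) * g (q - h) + (p - (q - h)) * g q - h * g p)"
        by (simp add: algebra_simps)
      have "\<bar>g q - g (q - h)\<bar> \<le> W" using W \<open>h \<le> q\<close> pq h by auto
      then have "\<bar>(q - p) * (g q - g (q - h))\<bar> \<le> (q - p) * W"
        using pq by (simp add: abs_mult mult_left_mono)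
      then show ?thesis using e ch[of "q - h" q p] \<open>h \<le> q\<close> pq by linarith
    qed
    moreover have "\<bar>h * (g q - g p)\<bar> = \<bar>g q - g p\<bar> * h" using h by (simp add: abs_mult)
    moreover have "(q - p) * W + h * B = ((q - p) / h * W + B) * h"
      using h by (simp add: field_simps)
    ultimately have "\<bar>g q - g p\<bar> * h \<le> ((q - p) / h * W + B) * h" by simp
    then show ?thesis using h by (simp only: mult_le_cancel_right_pos)
  qed
  define v where "v = (q - p) / h"
  define k where "k = nat \<lfloor>v\<rfloor>"
  have v: "v \<ge> 0" "q = p + v * h" using pq h by (auto simp: v_def)
  have k: "real k \<le> v" "v < real k + 1" using v by (auto simp: k_def)
  \<comment> \<open>Whole steps are cut off at the right end. Each costs only \<open>W\<close>, so
    \<open>B\<close> is paid once, on the rest from \<open>p\<close> to \<open>r\<close>.\<close>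
  define r where "r = q - real k * h"
  have kh: "real k * h \<le> v * h" "v * h \<le> (real k + 1) * h"
    using k h by (auto intro!: mult_right_mono)
  have r: "p \<le> r" "r \<le> q" "r - p \<le> h"
    using kh v h by (auto simp: r_def algebra_simps)
  \<comment> \<open>If at least one step was removed, then
    \<open>p + h \<le> q \<le> 1\<close>.\<close>
  have room': "p + h \<le> 1 \<or> h \<le> r"
  proof (cases "k = 0")
    case True
    then show ?thesis using room by (simp add: r_def)
  next
    case False
    then have "1 * h \<le> real k * h" using h by (intro mult_right_mono) auto
    then show ?thesis using kh v pq by auto
  qed
  have 1: "\<bar>g r - g p\<bar> \<le> (r - p) / h * W + B"
    by (rule short) (use r pq room' in auto)
  have qr: "q = r + real k * h" by (simp add: r_def)
  have 2: "\<bar>g (r + real k * h) - g r\<bar> \<le> real k * W"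
  proof (rule telescoped_increment[OF W])
    show "r \<in> {0..1}" using r pq by simp
    show "r + real k * h \<in> {0..1}" using pq unfolding qr[symmetric] by simp
  qed (use h in auto)
  have "(q - p) / h * W = (r - p) / h * W + real k * W"
    unfolding qr using h by (simp add: field_simps)
  moreover have "\<bar>g q - g r\<bar> \<le> real k * W" using 2 unfolding qr[symmetric] .
  ultimately show ?thesis using 1 by linarith
qed

section \<open>Estimates for positive functionals\<close>

text \<open>Only continuous arguments are constrained: in the instances additivity comes from
  integrals and needs integrability.\<close>

locale positive_functional =
  fixes L :: "(real \<Rightarrow> real) \<Rightarrow> real"
  assumes add: "continuous_on {0..1} f \<Longrightarrow> continuous_on {0..1} g \<Longrightarrow>
                  L (\<lambda>t. f t + g t) = L f + L g"
    and scale: "continuous_on {0..1} f \<Longrightarrow> L (\<lambda>t. c * f t) = c * L f"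
    and nonneg: "continuous_on {0..1} f \<Longrightarrow> (\<And>t. t \<in> {0..1} \<Longrightarrow> 0 \<le> f t) \<Longrightarrow> 0 \<le> L f"
    and one: "L (\<lambda>t. 1) = 1"
begin

lemma const: "L (\<lambda>t. c) = c"
  using scale[of "\<lambda>t. 1" c] one by simp

lemma diff:
  assumes "continuous_on {0..1} f" "continuous_on {0..1} g"
  shows "L (\<lambda>t. f t - g t) = L f - L g"
  using add[of f "\<lambda>t. - 1 * g t"] scale[of g "- 1"] assms by (simp add: continuous_on_minus)

lemma mono:
  assumes "continuous_on {0..1} f" "continuous_on {0..1} g" "\<And>t. t \<in> {0..1} \<Longrightarrow> f t \<le> g t"
  shows "L f \<le> L g"
  using nonneg[of "\<lambda>t. g t - f t"] diff[of g f] assms by (simp add: continuous_on_diff)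

lemma abs_le:
  assumes "continuous_on {0..1} f" "continuous_on {0..1} g" "\<And>t. t \<in> {0..1} \<Longrightarrow> \<bar>f t\<bar> \<le> g t"
  shows "\<bar>L f\<bar> \<le> L g"
proof -
  have "L f \<le> L g" by (rule mono) (use assms in \<open>auto simp: abs_le_iff\<close>)
  moreover have "L (\<lambda>t. - 1 * f t) \<le> L g"
    by (rule mono) (use assms in \<open>auto simp: abs_le_iff continuous_on_minus\<close>)
  ultimately show ?thesis using scale[of f "- 1"] assms(1) by auto
qed

lemma abs_le_const:
  assumes "continuous_on {0..1} f" "\<And>t. t \<in> {0..1} \<Longrightarrow> \<bar>f t\<bar> \<le> c"
  shows "\<bar>L f\<bar> \<le> c"
  using abs_le[of f "\<lambda>t. c"] assms const by simp

text \<open>A one-sided majorant \<open>g t \<le> g x + c (t - x) + B (1 + \<kappa> (t - x)\<^sup>2)\<close> with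
  \<open>\<bar>c\<bar> \<le> W / h\<close> suffices for each direction. All lower bounds that it imposes on the slope \<open>c\<close>
  are at most all upper bounds; for points on opposite sides of \<open>x\<close> this is the chord bound.\<close>
lemma upper_estimate:
  fixes g :: "real \<Rightarrow> real"
  assumes cont: "continuous_on {0..1} g" and eta: "\<eta> > 0" and B: "B \<ge> 0"
    and diff2: "\<And>y d. 0 \<le> d \<Longrightarrow> d \<le> \<eta> \<Longrightarrow> 0 \<le> y - d \<Longrightarrow> y + d \<le> 1 \<Longrightarrow>
                  \<bar>g (y - d) - 2 * g y + g (y + d)\<bar> \<le> B"
    and W: "\<And>p q. p \<in> {0..1} \<Longrightarrow> q \<in> {0..1} \<Longrightarrow> \<bar>p - q\<bar> \<le> h \<Longrightarrow> \<bar>g p - g q\<bar> \<le> W"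
    and h: "0 < h" "h \<le> 2 * \<eta>"
    and x: "0 \<le> x" "x \<le> 1" and room: "x + h \<le> 1 \<or> h \<le> x"
  shows "L g - g x \<le> W / h * \<bar>L (\<lambda>t. t) - x\<bar> + B * (1 + L (\<lambda>t. (t - x)\<^sup>2) / (2 * \<eta>\<^sup>2))"
proof -
  \<comment> \<open>The smallest value for which the chord bound holds on intervals of any
    length.\<close>
  define \<kappa> where "\<kappa> = 1 / (2 * \<eta>\<^sup>2)"
  have kappa: "\<kappa> \<ge> 0" "1 \<le> 2 * \<kappa> * \<eta>\<^sup>2" using eta by (auto simp: \<kappa>_def)
  define \<phi> where "\<phi> t = B * (1 + \<kappa> * (t - x)\<^sup>2)" for t
  have phiB: "B \<le> \<phi> t" for t unfolding \<phi>_def using B kappa by (simp add: algebra_simps)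
  have W0: "W \<ge> 0" using W[of 0 0] h by simp
  \<comment> \<open>The majorant asks for \<open>low t \<le> c\<close> at points
    \<open>t > x\<close> and for \<open>c \<le> upp s\<close> at points
    \<open>s < x\<close>.\<close>
  define low where "low t = (g t - g x - \<phi> t) / (t - x)" for t
  define upp where "upp s = (g x - g s + \<phi> s) / (x - s)" for s
  have lin: "\<bar>g q - g p\<bar> \<le> (q - p) / h * W + B"
    if "0 \<le> p" "p \<le> q" "q \<le> 1" "p + h \<le> 1 \<or> h \<le> q" for p q
    by (rule increment_le_linear[OF cont eta B diff2 W h]) (use that in auto)
  have low_le: "low t \<le> W / h" if "x < t" "t \<le> 1" for t
  proof -
    have "g t - g x - \<phi> t \<le> (t - x) / h * W"
      using lin[of x t] that x room phiB[of t] by auto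
    then show ?thesis using that h by (simp add: low_def divide_le_eq mult.commute)
  qed
  have upp_ge: "- (W / h) \<le> upp s" if "0 \<le> s" "s < x" for s
  proof -
    have "g s - g x - \<phi> s \<le> (x - s) / h * W"
      using lin[of s x] that x room phiB[of s] by auto
    moreover have "- (W / h) * (x - s) = - ((x - s) / h * W)" by simp
    ultimately have "- (W / h) * (x - s) \<le> g x - g s + \<phi> s" by linarith
    then show ?thesis using that by (simp only: upp_def pos_le_divide_eq diff_gt_0_iff_gt)
  qed
  have low_upp: "low t \<le> upp s" if st: "0 \<le> s" "s < x" "x < t" "t \<le> 1" for s t
  proof -
    have "(t - x) * g s + (x - s) * g t - (t - s) * g x
        \<le> (t - s) * (B * (1 + \<kappa> * (t - x) * (x - s)))"
    proof (rule chord_bound[where \<eta> = \<eta>])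
      show "continuous_on {s..t} g" by (rule continuous_on_subset[OF cont]) (use that in auto)
      show "g (y - d) - 2 * g y + g (y + d) \<le> B"
        if "0 \<le> d" "d \<le> \<eta>" "s \<le> y - d" "y + d \<le> t" for y d
        using diff2[of d y] that st by auto
    qed (use kappa eta B st in auto)
    \<comment> \<open>This identity is why \<open>\<phi>\<close> is quadratic in the distance to
      \<open>x\<close>: weighting \<open>\<phi> s\<close> and \<open>\<phi> t\<close> as in the
      chord reproduces the product term of the chord bound exactly.\<close>
    moreover have "(t - s) * (B * (1 + \<kappa> * (t - x) * (x - s))) = (t - x) * \<phi> s + (x - s) * \<phi> t"
      by (simp add: \<phi>_def algebra_simps power2_eq_square)
    ultimately have "(g t - g x - \<phi> t) * (x - s) \<le> (g x - g s + \<phi> s) * (t - x)"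
      by (simp add: algebra_simps)
    then show ?thesis using st unfolding low_def upp_def
      by (simp add: divide_le_eq le_divide_eq)
  qed
  \<comment> \<open>Inserting \<open>- (W / h)\<close> keeps the set nonempty at
    \<open>x = 1\<close> and yields the lower bound on the slope.\<close>
  define A where "A = insert (- (W / h)) (low ` {x<..1})"
  have "bdd_above A" unfolding A_def
    by (intro bdd_aboveI[of _ "W / h"]) (use low_le W0 h in \<open>auto intro: order_trans[of _ 0]\<close>)
  define c where "c = Sup A"
  have c1: "- (W / h) \<le> c" "\<And>t. x < t \<Longrightarrow> t \<le> 1 \<Longrightarrow> low t \<le> c"
    unfolding c_def by (rule cSup_upper; use \<open>bdd_above A\<close> in \<open>auto simp: A_def\<close>)+
  have c2: "c \<le> W / h"
    unfolding c_def using low_le W0 h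
    by (intro cSup_least) (auto simp: A_def intro: order_trans[of _ 0])
  have c3: "c \<le> upp s" if "0 \<le> s" "s < x" for s
    unfolding c_def using low_upp upp_ge that
    by (intro cSup_least) (auto simp: A_def)
  have major: "g t - g x - c * (t - x) \<le> \<phi> t" if "t \<in> {0..1}" for t
  proof -
    consider "t = x" | "x < t" | "t < x" by linarith
    then show ?thesis
    proof cases
      case 1
      then show ?thesis using phiB[of x] B by simp
    next
      case 2
      then have "g t - g x - \<phi> t \<le> c * (t - x)"
        using c1(2)[of t] that by (simp add: low_def divide_le_eq)
      then show ?thesis by simp
    next
      case 3
      then have "c * (x - t) \<le> g x - g t + \<phi> t"
        using c3[of t] that by (simp add: upp_def le_divide_eq)
      then show ?thesis by (simp add: algebra_simps)
    qed
  qed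
  have "L (\<lambda>t. g t - g x - c * (t - x)) \<le> L \<phi>"
    by (rule mono) (use major in \<open>auto simp: \<phi>_def intro!: continuous_intros cont\<close>)
  moreover have "L (\<lambda>t. g t - g x - c * (t - x)) = L g - g x - c * (L (\<lambda>t. t) - x)"
    by (subst diff, (intro continuous_intros cont)+)+
       (simp add: const scale continuous_intros diff)
  moreover have "L \<phi> = B * (1 + \<kappa> * L (\<lambda>t. (t - x)\<^sup>2))"
    unfolding \<phi>_def by (simp add: const scale add continuous_intros one)
  moreover have "c * (L (\<lambda>t. t) - x) \<le> W / h * \<bar>L (\<lambda>t. t) - x\<bar>"
  proof -
    have "\<bar>c\<bar> \<le> W / h" using c1(1) c2 by auto
    then have "\<bar>c * (L (\<lambda>t. t) - x)\<bar> \<le> W / h * \<bar>L (\<lambda>t. t) - x\<bar>"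
      unfolding abs_mult by (intro mult_right_mono) auto
    then show ?thesis by simp
  qed
  ultimately show ?thesis by (simp add: \<kappa>_def)
qed

text \<open>The hypotheses hold for \<open>g\<close> and \<open>- g\<close> alike, so the one-sided
  estimate applies to both. The steps \<open>h\<close> and \<open>\<eta>\<close> are independent up
  to \<open>h \<le> 2 * \<eta>\<close>, which the Durrmeyer operator of degree 0 exploits.\<close>

lemma modulus_estimate:
  fixes g :: "real \<Rightarrow> real"
  assumes cont: "continuous_on {0..1} g" and eta: "\<eta> > 0" and B: "B \<ge> 0"
    and diff2: "\<And>y d. 0 \<le> d \<Longrightarrow> d \<le> \<eta> \<Longrightarrow> 0 \<le> y - d \<Longrightarrow> y + d \<le> 1 \<Longrightarrow>
                  \<bar>g (y - d) - 2 * g y + g (y + d)\<bar> \<le> B"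
    and W: "\<And>p q. p \<in> {0..1} \<Longrightarrow> q \<in> {0..1} \<Longrightarrow> \<bar>p - q\<bar> \<le> h \<Longrightarrow> \<bar>g p - g q\<bar> \<le> W"
    and h: "0 < h" "h \<le> 2 * \<eta>"
    and x: "0 \<le> x" "x \<le> 1" and room: "x + h \<le> 1 \<or> h \<le> x"
  shows "\<bar>L g - g x\<bar> \<le> W / h * \<bar>L (\<lambda>t. t) - x\<bar> + B * (1 + L (\<lambda>t. (t - x)\<^sup>2) / (2 * \<eta>\<^sup>2))"
proof -
  have "L (\<lambda>t. - g t) - - g x
      \<le> W / h * \<bar>L (\<lambda>t. t) - x\<bar> + B * (1 + L (\<lambda>t. (t - x)\<^sup>2) / (2 * \<eta>\<^sup>2))"
  proof (rule upper_estimate[OF _ eta B _ _ h x room])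
    show "\<bar>- g (y - d) - 2 * - g y + - g (y + d)\<bar> \<le> B"
      if "0 \<le> d" "d \<le> \<eta>" "0 \<le> y - d" "y + d \<le> 1" for y d
      using diff2[OF that] by (simp add: abs_le_iff)
    show "\<bar>- g p - - g q\<bar> \<le> W" if "p \<in> {0..1}" "q \<in> {0..1}" "\<bar>p - q\<bar> \<le> h" for p q
      using W[OF that] by (simp add: abs_minus_commute)
  qed (intro continuous_intros cont)
  moreover have "L (\<lambda>t. - g t) = - L g" using scale[OF cont, of "- 1"] by simp
  ultimately show ?thesis
    using upper_estimate[OF assms] by (simp add: abs_le_iff)
qed

end

section \<open>Durrmeyer and genuine Bernstein-Durrmeyer operators\<close>

text \<open>Factorial moments of the binomial distribution: choosing \<open>r\<close> out of the
  \<open>k\<close> chosen elements first leaves a partition of unity of degree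
  \<open>n - r\<close>.\<close>

lemma sum_Bernstein_binomial:
  "(\<Sum>k\<le>n. Bernstein n k x * real (k choose r)) = real (n choose r) * x ^ r"
proof (cases "r \<le> n")
  case True
  have "(\<Sum>k\<le>n. Bernstein n k x * real (k choose r)) =
      (\<Sum>k\<in>{r..n}. Bernstein n k x * real (k choose r))"
    by (intro sum.mono_neutral_right) auto
  also have "\<dots> = (\<Sum>j\<le>n - r. Bernstein n (j + r) x * real (j + r choose r))"
    by (rule sum.reindex_bij_witness[of _ "\<lambda>j. j + r" "\<lambda>k. k - r"]) (use True in auto)
  also have "\<dots> = (\<Sum>j\<le>n - r. real (n choose r) * x ^ r * Bernstein (n - r) j x)"
  proof (rule sum.cong)
    fix j assume "j \<in> {..n - r}"
    then have "j + r \<le> n" using True by auto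
    then have "(n choose (j + r)) * ((j + r) choose r) = (n choose r) * ((n - r) choose j)"
      using choose_mult[of r "j + r" n] by simp
    then have "real (n choose (j + r)) * real ((j + r) choose r) =
        real (n choose r) * real ((n - r) choose j)"
      by (metis of_nat_mult)
    then show "Bernstein n (j + r) x * real (j + r choose r) =
        real (n choose r) * x ^ r * Bernstein (n - r) j x"
      by (simp add: Bernstein_def power_add algebra_simps)
  qed simp
  also have "\<dots> = real (n choose r) * x ^ r"
    by (simp flip: sum_distrib_left)
  finally show ?thesis .
next
  case False
  then show ?thesis by (simp add: binomial_eq_0)
qed

lemma has_real_derivative_Bernstein_Suc:
  "(Bernstein (Suc m) (Suc k) has_real_derivative
      real (Suc m) * (Bernstein m k t - Bernstein m (Suc k) t)) (at t within S)"
proof -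
  consider "k < m" | "k = m" | "k > m" by linarith
  then show ?thesis
  proof cases
    case 1
    then obtain j where m: "m = Suc (k + j)" using less_iff_Suc_add by auto
    have a: "real (Suc k) * real (Suc m choose Suc k) = real (Suc m) * real (m choose k)"
      by (metis Suc_times_binomial of_nat_mult)
    have "(Suc m - Suc k) * (Suc m choose Suc k) = Suc m * (m choose Suc k)"
      using binomial_absorb_comp[of "Suc m" "Suc k"] by simp
    then have b: "real (Suc j) * real (Suc m choose Suc k) = real (Suc m) * real (m choose Suc k)"
      unfolding m by (metis Suc_diff_Suc add_diff_cancel_left' diff_Suc_Suc diff_diff_left of_nat_mult
          add_Suc_right)
    have "(Bernstein (Suc m) (Suc k) has_real_derivative
        real (Suc k) * real (Suc m choose Suc k) * t ^ k * (1 - t) ^ Suc j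
        - real (Suc j) * real (Suc m choose Suc k) * t ^ Suc k * (1 - t) ^ j) (at t within S)"
      unfolding Bernstein_def[abs_def] m
      by (rule derivative_eq_intros refl | simp add: algebra_simps del: of_nat_Suc binomial_Suc_Suc)+
    then show ?thesis unfolding a b by (simp add: Bernstein_def m algebra_simps)
  next
    case 2
    have "Bernstein (Suc m) (Suc m) = (\<lambda>t. t ^ Suc m)"
      by (auto simp: Bernstein_def simp del: power_Suc)
    moreover have "((\<lambda>t. t ^ Suc m) has_real_derivative real (Suc m) * t ^ m) (at t within S)"
      using DERIV_pow[of "Suc m" t S] by simp
    ultimately show ?thesis using 2 by (simp add: Bernstein_def binomial_eq_0)
  next
    case 3
    then show ?thesis unfolding Bernstein_def[abs_def]
      by (simp add: binomial_eq_0)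
  qed
qed

text \<open>At \<open>m = 0\<close> the truncated degree \<open>m - 1\<close> is harmless, since the
  factor \<open>m\<close> vanishes.\<close>

lemma has_real_derivative_Bernstein_0:
  "(Bernstein m 0 has_real_derivative - (real m * Bernstein (m - 1) 0 t)) (at t within S)"
  unfolding Bernstein_def[abs_def] by (auto intro!: derivative_eq_intros)

lemma Bernstein_eq_0: "m < k \<Longrightarrow> Bernstein m k x = 0"
  by (simp add: Bernstein_def)

lemma continuous_on_Bernstein [continuous_intros]:
  "continuous_on S f \<Longrightarrow> continuous_on S (\<lambda>x. Bernstein n k (f x))"
  unfolding Bernstein_def by (intro continuous_intros)

text \<open>Integrating the derivative formula shows that neighbouring indices have equal integrals,
  because \<open>Bernstein (Suc m) (Suc k)\<close> vanishes at 0 and 1 for \<open>k < m\<close>. The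
  induction descends from \<open>k = m\<close>, where its value at 1 is 1.\<close>

lemma has_integral_Bernstein:
  assumes "k \<le> m"
  shows "(Bernstein m k has_integral 1 / real (Suc m)) {0..1}"
  using assms
proof (induction k rule: inc_induct)
  case base
  have "((\<lambda>t. real (Suc m) * (Bernstein m m t - Bernstein m (Suc m) t)) has_integral
      Bernstein (Suc m) (Suc m) 1 - Bernstein (Suc m) (Suc m) 0) {0..1}"
    by (rule fundamental_theorem_of_calculus)
       (simp_all del: of_nat_Suc add: has_real_derivative_Bernstein_Suc
             flip: has_real_derivative_iff_has_vector_derivative)
  from has_integral_mult_right[OF this, of "1 / real (Suc m)"]
  show ?case by (simp add: Bernstein_def binomial_eq_0)
next
  case (step k)
  have "((\<lambda>t. real (Suc m) * (Bernstein m k t - Bernstein m (Suc k) t)) has_integral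
      Bernstein (Suc m) (Suc k) 1 - Bernstein (Suc m) (Suc k) 0) {0..1}"
    by (rule fundamental_theorem_of_calculus)
       (simp_all del: of_nat_Suc add: has_real_derivative_Bernstein_Suc
             flip: has_real_derivative_iff_has_vector_derivative)
  from has_integral_mult_right[OF this, of "1 / real (Suc m)"]
  have "((\<lambda>t. Bernstein m k t - Bernstein m (Suc k) t) has_integral 0) {0..1}"
    using step.hyps by (simp add: Bernstein_def power_0_left)
  from has_integral_add[OF this step.IH] show ?case by simp
qed

text \<open>Multiplication by \<open>t ^ r\<close> raises degree and index by \<open>r\<close>, up
  to a quotient of binomial coefficients.\<close>

lemma has_integral_Bernstein_power:
  assumes "k \<le> m"
  shows "((\<lambda>t. Bernstein m k t * t ^ r) has_integral
           real ((k + r) choose r) / (real (Suc m) * real ((Suc m + r) choose r))) {0..1}"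
proof -
  have 1: "real ((m + r) choose (k + r)) * real ((k + r) choose r)
      = real ((m + r) choose r) * real (m choose k)"
    using choose_mult[of r "k + r" "m + r"] assms by (simp flip: of_nat_mult)
  have "Suc m * ((Suc m + r) choose r) = Suc (m + r) * ((m + r) choose r)"
    using binomial_absorb_comp[of "Suc m + r" r] by simp
  then have 2: "real (Suc m) * real ((Suc m + r) choose r) = real (Suc (m + r)) * real ((m + r) choose r)"
    by (metis of_nat_mult)
  have pos: "real ((m + r) choose (k + r)) > 0" "real ((m + r) choose r) > 0"
    using assms by (auto simp: zero_less_binomial_iff)
  define c where "c = real (m choose k) / real ((m + r) choose (k + r))"
  have "Bernstein m k t * t ^ r = c * Bernstein (m + r) (k + r) t" for t
    using pos by (simp add: Bernstein_def c_def power_add)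
  moreover have "((\<lambda>t. c * Bernstein (m + r) (k + r) t) has_integral c * (1 / real (Suc (m + r)))) {0..1}"
    by (intro has_integral_mult_right has_integral_Bernstein) (use assms in simp)
  moreover have "c * (1 / real (Suc (m + r))) =
      real ((k + r) choose r) / (real (Suc m) * real ((Suc m + r) choose r))"
  proof -
    have "c * real ((m + r) choose r) = real ((k + r) choose r)"
      using 1 pos by (simp add: c_def field_simps)
    then show ?thesis unfolding 2 using pos
      by (simp add: field_simps del: of_nat_Suc)
  qed
  ultimately show ?thesis by simp
qed

section \<open>The two operators as positive functionals\<close>

definition durrmeyer :: "nat \<Rightarrow> (real \<Rightarrow> real) \<Rightarrow> real \<Rightarrow> real" where
  "durrmeyer m g x = (\<Sum>k\<le>m. Bernstein m k x *
     (real (Suc m) * integral {0..1} (\<lambda>t. Bernstein m k t * g t)))"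

text \<open>Collecting point values and integrals in one coefficient sequence lets the genuine and
  the modified operator share it, and lets its differences be formed. The degree
  \<open>n - 2\<close> is reached only for \<open>0 < k < n\<close>, where it does not
  truncate.\<close>

definition genuine_coeff :: "nat \<Rightarrow> (real \<Rightarrow> real) \<Rightarrow> nat \<Rightarrow> real" where
  "genuine_coeff n f k =
     (if k = 0 then f 0 else if k = n then f 1
      else (real n - 1) * integral {0..1} (\<lambda>t. Bernstein (n - 2) (k - 1) t * f t))"

definition genuine_BD :: "nat \<Rightarrow> (real \<Rightarrow> real) \<Rightarrow> real \<Rightarrow> real" where
  "genuine_BD n f x = (\<Sum>k\<le>n. Bernstein n k x * genuine_coeff n f k)"

lemma Bernstein_mult_integrable:
  fixes f :: "real \<Rightarrow> real"
  assumes "continuous_on {0..1} f"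
  shows "(\<lambda>t. Bernstein m k t * f t) integrable_on {0..1}"
  by (intro integrable_continuous_interval continuous_intros assms)

lemma integral_Bernstein_mult_add:
  fixes f g :: "real \<Rightarrow> real"
  assumes "continuous_on {0..1} f" "continuous_on {0..1} g"
  shows "integral {0..1} (\<lambda>t. Bernstein m k t * (f t + g t)) =
    integral {0..1} (\<lambda>t. Bernstein m k t * f t) + integral {0..1} (\<lambda>t. Bernstein m k t * g t)"
  unfolding distrib_left by (intro Henstock_Kurzweil_Integration.integral_add Bernstein_mult_integrable assms)

lemma integral_Bernstein_mult_scale:
  fixes f :: "real \<Rightarrow> real"
  shows "integral {0..1} (\<lambda>t. Bernstein m k t * (c * f t)) =
    c * integral {0..1} (\<lambda>t. Bernstein m k t * f t)"
  by (simp only: mult.left_commute[of _ c] integral_mult_right)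

lemma integral_Bernstein_mult_nonneg:
  fixes f :: "real \<Rightarrow> real"
  assumes "continuous_on {0..1} f" "\<And>t. t \<in> {0..1} \<Longrightarrow> 0 \<le> f t"
  shows "0 \<le> integral {0..1} (\<lambda>t. Bernstein m k t * f t)"
  by (intro integral_nonneg Bernstein_mult_integrable assms)
     (use assms(2) in \<open>auto intro!: mult_nonneg_nonneg Bernstein_nonneg\<close>)

lemma durrmeyer_power:
  "durrmeyer m (\<lambda>t. t ^ r) x =
     (\<Sum>k\<le>m. Bernstein m k x * real ((k + r) choose r)) / real ((Suc m + r) choose r)"
proof -
  have "integral {0..1} (\<lambda>t. Bernstein m k t * t ^ r) =
      real ((k + r) choose r) / (real (Suc m) * real ((Suc m + r) choose r))" if "k \<le> m" for k
    using has_integral_Bernstein_power[OF that] by (rule integral_unique)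
  then show ?thesis
    unfolding durrmeyer_def sum_divide_distrib by (intro sum.cong) (auto simp del: of_nat_Suc)
qed

lemma positive_functional_durrmeyer:
  assumes "x \<in> {0..1}"
  shows "positive_functional (\<lambda>g. durrmeyer m g x)"
proof
  show "durrmeyer m (\<lambda>t. f t + g t) x = durrmeyer m f x + durrmeyer m g x"
    if "continuous_on {0..1} f" "continuous_on {0..1} g" for f g
    using that unfolding durrmeyer_def
    by (simp add: integral_Bernstein_mult_add) (simp add: distrib_left sum.distrib)
  show "durrmeyer m (\<lambda>t. c * f t) x = c * durrmeyer m f x" for f c
    unfolding durrmeyer_def
    by (simp add: integral_Bernstein_mult_scale sum_distrib_left mult_ac)
  show "0 \<le> durrmeyer m f x"
    if "continuous_on {0..1} f" "\<And>t. t \<in> {0..1} \<Longrightarrow> 0 \<le> f t" for f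
    using that assms unfolding durrmeyer_def
    by (intro sum_nonneg mult_nonneg_nonneg Bernstein_nonneg integral_Bernstein_mult_nonneg) auto
  show "durrmeyer m (\<lambda>t. 1) x = 1"
    using durrmeyer_power[of m 0 x] by simp
qed

text \<open>Removes the truncated subtractions \<open>k - 1\<close> and \<open>n - 2\<close> and
  supplies the bound on the index required by the integral formulas.\<close>

lemma inner_index:
  assumes "0 < k" "k < n"
  obtains j m where "k = Suc j" "n = Suc (Suc m)" "j \<le> m"
proof -
  obtain j where j: "k = Suc j" using assms gr0_implies_Suc by blast
  obtain i where "n = Suc (k + i)" using less_imp_Suc_add[OF assms(2)] by blast
  then show thesis using that[of j "j + i"] j by simp
qed

text \<open>For positive exponents the binomial quotient is 0 at \<open>k = 0\<close> and 1 at
  \<open>k = n\<close>, matching the point values there, so one formula covers all indices.\<close>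

lemma genuine_coeff_power:
  assumes "k \<le> n" "n \<ge> 1"
  shows "genuine_coeff n (\<lambda>t. t ^ Suc s) k = real ((k + s) choose Suc s) / real ((n + s) choose Suc s)"
proof -
  consider "k = 0" | "k = n" "k \<noteq> 0" | "0 < k" "k < n" using assms by linarith
  then show ?thesis
  proof cases
    case 3
    then obtain j m where jm: "k = Suc j" "n = Suc (Suc m)" "j \<le> m"
      by (rule inner_index)
    have "real (Suc (Suc m)) - 1 = real (Suc m)" by simp
    note [simp] = this
    show ?thesis
      using integral_unique[OF has_integral_Bernstein_power[OF jm(3), of "Suc s"]] 3 jm
      by (simp add: genuine_coeff_def del: power_Suc binomial_Suc_Suc of_nat_Suc)
  next
    case 2
    have "real ((n + s) choose Suc s) > 0" using assms by (simp add: zero_less_binomial_iff del: binomial_Suc_Suc)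
    then show ?thesis using 2 by (simp add: genuine_coeff_def del: binomial_Suc_Suc)
  qed (simp add: genuine_coeff_def binomial_eq_0)
qed

lemma genuine_BD_power:
  assumes "n \<ge> 1"
  shows "genuine_BD n (\<lambda>t. t ^ Suc s) x =
     (\<Sum>k\<le>n. Bernstein n k x * real ((k + s) choose Suc s)) / real ((n + s) choose Suc s)"
  unfolding genuine_BD_def sum_divide_distrib
  by (intro sum.cong) (use assms in \<open>simp_all add: genuine_coeff_power del: power_Suc\<close>)

lemma positive_functional_genuine_BD:
  assumes "x \<in> {0..1}" "n \<ge> 1"
  shows "positive_functional (\<lambda>g. genuine_BD n g x)"
proof
  show "genuine_BD n (\<lambda>t. f t + g t) x = genuine_BD n f x + genuine_BD n g x"
    if "continuous_on {0..1} f" "continuous_on {0..1} g" for f g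
  proof -
    have "genuine_coeff n (\<lambda>t. f t + g t) k = genuine_coeff n f k + genuine_coeff n g k" for k
      using that
      by (simp add: genuine_coeff_def integral_Bernstein_mult_add) (simp add: distrib_left)
    then show ?thesis by (simp add: genuine_BD_def distrib_left sum.distrib)
  qed
  show "genuine_BD n (\<lambda>t. c * f t) x = c * genuine_BD n f x" for f c
    unfolding genuine_BD_def sum_distrib_left
    by (intro sum.cong) (auto simp: genuine_coeff_def integral_Bernstein_mult_scale)
  show "0 \<le> genuine_BD n f x"
    if "continuous_on {0..1} f" "\<And>t. t \<in> {0..1} \<Longrightarrow> 0 \<le> f t" for f
  proof -
    have "0 \<le> genuine_coeff n f k" for k
      using integral_Bernstein_mult_nonneg[OF that] that(2)[of 0] that(2)[of 1] assms
      by (simp add: genuine_coeff_def)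
    then show ?thesis
      using assms unfolding genuine_BD_def
      by (intro sum_nonneg mult_nonneg_nonneg Bernstein_nonneg) auto
  qed
  \<comment> \<open>The power formula starts at exponent 1, so constants are treated
    separately.\<close>
  have "genuine_coeff n (\<lambda>t. 1) k = 1" if "k \<le> n" for k
  proof -
    consider "k = 0" | "k = n" | "0 < k" "k < n" using \<open>k \<le> n\<close> by linarith
    then show ?thesis
    proof cases
      case 3
      then obtain j m where jm: "k = Suc j" "n = Suc (Suc m)" "j \<le> m"
        by (rule inner_index)
      show ?thesis unfolding genuine_coeff_def jm
        using integral_unique[OF has_integral_Bernstein[OF jm(3)]] 3 jm
        by (simp add: field_simps)
    qed (auto simp: genuine_coeff_def)
  qed
  then show "genuine_BD n (\<lambda>t. 1) x = 1" by (simp add: genuine_BD_def)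
qed

section \<open>Moments up to order four\<close>

lemma binomial_real:
  "real (n choose 2) = real n * (real n - 1) / 2"
  "real (n choose 3) = real n * (real n - 1) * (real n - 2) / 6"
  "real (n choose 4) = real n * (real n - 1) * (real n - 2) * (real n - 3) / 24"
proof -
  show 2: "real (n choose 2) = real n * (real n - 1) / 2" for n
    by (induction n) (auto simp: numeral_2_eq_2 field_simps)
  show 3: "real (n choose 3) = real n * (real n - 1) * (real n - 2) / 6" for n
  proof (induction n)
    case (Suc n)
    have "Suc n choose 3 = (n choose 2) + (n choose 3)"
      by (simp add: numeral_3_eq_3 numeral_2_eq_2)
    then show ?case using Suc 2[of n] by (simp add: algebra_simps)
  qed simp
  show "real (n choose 4) = real n * (real n - 1) * (real n - 2) * (real n - 3) / 24"
  proof (induction n)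
    case (Suc n)
    have "Suc n choose 4 = (n choose 3) + (n choose 4)"
      by (simp add: numeral_eq_Suc)
    then show ?case using Suc 3[of n] by (simp add: algebra_simps)
  qed simp
qed

text \<open>Vandermonde expansions: integrals produce binomials with a shifted upper index, while
  the summation formula needs them over \<open>k\<close> itself.\<close>

lemma rising_binomial:
  "(k + 1) choose 2 = (k choose 2) + (k choose 1)"
  "(k + 2) choose 2 = (k choose 2) + 2 * (k choose 1) + 1"
  "(k + 2) choose 3 = (k choose 3) + 2 * (k choose 2) + (k choose 1)"
  "(k + 3) choose 4 = (k choose 4) + 3 * (k choose 3) + 3 * (k choose 2) + (k choose 1)"
  by (simp_all add: numeral_eq_Suc)

lemma sum_Bernstein_binomial_1: "(\<Sum>k\<le>n. Bernstein n k x * real k) = real n * x"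
  using sum_Bernstein_binomial[of n x 1] by simp

lemma durrmeyer_moments:
  "durrmeyer m (\<lambda>t. t) x = (real m * x + 1) / (real m + 2)"
  "durrmeyer m (\<lambda>t. t\<^sup>2) x =
     (real m * (real m - 1) * x\<^sup>2 + 4 * real m * x + 2) / ((real m + 2) * (real m + 3))"
proof -
  show "durrmeyer m (\<lambda>t. t) x = (real m * x + 1) / (real m + 2)"
    using durrmeyer_power[of m 1 x]
    by (simp add: distrib_left sum.distrib sum_Bernstein_binomial_1 add_ac)
  have "(\<Sum>k\<le>m. Bernstein m k x * real ((k + 2) choose 2)) =
      (\<Sum>k\<le>m. Bernstein m k x * real (k choose 2)) + 2 * (\<Sum>k\<le>m. Bernstein m k x * real k)
        + (\<Sum>k\<le>m. Bernstein m k x)"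
    unfolding rising_binomial sum_distrib_left sum.distrib[symmetric]
    by (intro sum.cong) (auto simp: algebra_simps)
  also have "\<dots> = 1 / 2 * (real m * (real m - 1) * x\<^sup>2 + 4 * real m * x + 2)"
    unfolding sum_Bernstein_binomial sum_Bernstein_binomial_1 sum_Bernstein
    by (simp add: binomial_real field_simps)
  finally have 1: "(\<Sum>k\<le>m. Bernstein m k x * real ((k + 2) choose 2)) = \<dots>" .
  have 2: "real (Suc m + 2 choose 2) = 1 / 2 * ((real m + 2) * (real m + 3))"
    by (simp only: binomial_real) (simp add: algebra_simps)
  show "durrmeyer m (\<lambda>t. t\<^sup>2) x =
     (real m * (real m - 1) * x\<^sup>2 + 4 * real m * x + 2) / ((real m + 2) * (real m + 3))"
    unfolding durrmeyer_power 1 2 by (rule mult_divide_mult_cancel_left) simp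
qed

lemma genuine_BD_moments:
  assumes n: "n \<ge> 1"
  shows "genuine_BD n (\<lambda>t. t) x = x"
  "genuine_BD n (\<lambda>t. t\<^sup>2) x = (2 * x + (real n - 1) * x\<^sup>2) / (real n + 1)"
  "genuine_BD n (\<lambda>t. t ^ 3) x =
     (6 * x + 6 * (real n - 1) * x\<^sup>2 + (real n - 1) * (real n - 2) * x ^ 3)
       / ((real n + 1) * (real n + 2))"
  "genuine_BD n (\<lambda>t. t ^ 4) x =
     (24 * x + 36 * (real n - 1) * x\<^sup>2 + 12 * (real n - 1) * (real n - 2) * x ^ 3
        + (real n - 1) * (real n - 2) * (real n - 3) * x ^ 4)
       / ((real n + 1) * (real n + 2) * (real n + 3))"
proof -
  define b where "b r = (\<Sum>k\<le>n. Bernstein n k x * real (k choose r))" for r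
  have b: "b 1 = real n * x" "b 2 = real n * (real n - 1) / 2 * x\<^sup>2"
    "b 3 = real n * (real n - 1) * (real n - 2) / 6 * x ^ 3"
    "b 4 = real n * (real n - 1) * (real n - 2) * (real n - 3) / 24 * x ^ 4"
    unfolding b_def sum_Bernstein_binomial by (simp_all add: binomial_real)
  have n0: "real n \<noteq> 0" using n by simp
  show "genuine_BD n (\<lambda>t. t) x = x"
    using genuine_BD_power[OF n, of 0 x] n0 by (simp add: sum_Bernstein_binomial_1)
  have *: "genuine_BD n (\<lambda>t. t\<^sup>2) x = (b 2 + b 1) / real (n + 1 choose 2)"
    using genuine_BD_power[OF n, of 1 x] rising_binomial(1)
    by (simp add: b_def distrib_left sum.distrib numeral_2_eq_2)
  show "genuine_BD n (\<lambda>t. t\<^sup>2) x = (2 * x + (real n - 1) * x\<^sup>2) / (real n + 1)"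
  proof -
    \<comment> \<open>Numerator and denominator are written with the common factor
      \<open>real n / 2\<close>, nonzero by \<open>n \<ge> 1\<close>; the third and fourth moments
      are treated the same way.\<close>
    have 1: "b 2 + b 1 = real n / 2 * (2 * x + (real n - 1) * x\<^sup>2)"
      unfolding b by (simp add: field_simps power2_eq_square)
    have 2: "real (n + 1 choose 2) = real n / 2 * (real n + 1)"
      unfolding binomial_real by (simp add: field_simps)
    show ?thesis unfolding * 1 2 by (rule mult_divide_mult_cancel_left) (use n in simp)
  qed
  have *: "genuine_BD n (\<lambda>t. t ^ 3) x = (b 3 + 2 * b 2 + b 1) / real (n + 2 choose 3)"
  proof -
    have "genuine_BD n (\<lambda>t. t ^ 3) x =
        (\<Sum>k\<le>n. Bernstein n k x * real ((k + 2) choose 3)) / real (n + 2 choose 3)"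
      using genuine_BD_power[OF n, of 2 x] by (simp only: eval_nat_numeral)
    also have "(\<Sum>k\<le>n. Bernstein n k x * real ((k + 2) choose 3)) = b 3 + 2 * b 2 + b 1"
      unfolding b_def rising_binomial sum_distrib_left sum.distrib[symmetric]
      by (intro sum.cong) (auto simp: algebra_simps)
    finally show ?thesis .
  qed
  show "genuine_BD n (\<lambda>t. t ^ 3) x =
     (6 * x + 6 * (real n - 1) * x\<^sup>2 + (real n - 1) * (real n - 2) * x ^ 3)
       / ((real n + 1) * (real n + 2))"
  proof -
    have 1: "b 3 + 2 * b 2 + b 1 = real n / 6 * (6 * x + 6 * (real n - 1) * x\<^sup>2 + (real n - 1) * (real n - 2) * x ^ 3)"
      unfolding b by (simp add: field_simps power2_eq_square)
    have 2: "real (n + 2 choose 3) = real n / 6 * ((real n + 1) * (real n + 2))"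
      unfolding binomial_real by (simp add: field_simps)
    show ?thesis unfolding * 1 2 by (rule mult_divide_mult_cancel_left) (use n in simp)
  qed
  have *: "genuine_BD n (\<lambda>t. t ^ 4) x = (b 4 + 3 * b 3 + 3 * b 2 + b 1) / real (n + 3 choose 4)"
  proof -
    have "genuine_BD n (\<lambda>t. t ^ 4) x =
        (\<Sum>k\<le>n. Bernstein n k x * real ((k + 3) choose 4)) / real (n + 3 choose 4)"
      using genuine_BD_power[OF n, of 3 x] by simp
    also have "(\<Sum>k\<le>n. Bernstein n k x * real ((k + 3) choose 4)) = b 4 + 3 * b 3 + 3 * b 2 + b 1"
      unfolding b_def rising_binomial sum_distrib_left sum.distrib[symmetric]
      by (intro sum.cong) (auto simp: algebra_simps)
    finally show ?thesis .
  qed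
  show "genuine_BD n (\<lambda>t. t ^ 4) x =
     (24 * x + 36 * (real n - 1) * x\<^sup>2 + 12 * (real n - 1) * (real n - 2) * x ^ 3
        + (real n - 1) * (real n - 2) * (real n - 3) * x ^ 4)
       / ((real n + 1) * (real n + 2) * (real n + 3))"
  proof -
    have 1: "b 4 + 3 * b 3 + 3 * b 2 + b 1 = real n / 24 * (24 * x + 36 * (real n - 1) * x\<^sup>2 + 12 * (real n - 1) * (real n - 2) * x ^ 3
        + (real n - 1) * (real n - 2) * (real n - 3) * x ^ 4)"
      unfolding b by (simp add: field_simps power2_eq_square)
    have 2: "real (n + 3 choose 4) = real n / 24 * ((real n + 1) * (real n + 2) * (real n + 3))"
      unfolding binomial_real by (simp add: field_simps)
    show ?thesis unfolding * 1 2 by (rule mult_divide_mult_cancel_left) (use n in simp)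
  qed
qed

lemma (in positive_functional) centered_moments:
  "L (\<lambda>t. (t - x)\<^sup>2) = L (\<lambda>t. t\<^sup>2) - 2 * x * L (\<lambda>t. t) + x\<^sup>2"
  "L (\<lambda>t. (t - x) ^ 4) = L (\<lambda>t. t ^ 4) - 4 * x * L (\<lambda>t. t ^ 3) + 6 * x\<^sup>2 * L (\<lambda>t. t\<^sup>2)
     - 4 * x ^ 3 * L (\<lambda>t. t) + x ^ 4"
proof -
  have 1: "(\<lambda>t. (t - x)\<^sup>2) = (\<lambda>t. t\<^sup>2 + ((- 2 * x) * t + x\<^sup>2))"
    by (auto simp: power2_eq_square algebra_simps)
  have 2: "L (\<lambda>t. t\<^sup>2 + (a * t + b)) = L (\<lambda>t. t\<^sup>2) + (a * L (\<lambda>t. t) + b)" for a b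
    by (simp add: add scale const continuous_intros)
  show "L (\<lambda>t. (t - x)\<^sup>2) = L (\<lambda>t. t\<^sup>2) - 2 * x * L (\<lambda>t. t) + x\<^sup>2"
    unfolding 1 2 by simp
  have 3: "(\<lambda>t. (t - x) ^ 4) =
      (\<lambda>t. t ^ 4 + ((- 4 * x) * t ^ 3 + ((6 * x\<^sup>2) * t\<^sup>2 + ((- 4 * x ^ 3) * t + x ^ 4))))"
    by (auto simp: eval_nat_numeral algebra_simps)
  have 4: "L (\<lambda>t. t ^ 4 + (a * t ^ 3 + (b * t\<^sup>2 + (c * t + d)))) =
      L (\<lambda>t. t ^ 4) + (a * L (\<lambda>t. t ^ 3) + (b * L (\<lambda>t. t\<^sup>2) + (c * L (\<lambda>t. t) + d)))" for a b c d
    by (simp add: add scale const continuous_intros)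
  show "L (\<lambda>t. (t - x) ^ 4) = L (\<lambda>t. t ^ 4) - 4 * x * L (\<lambda>t. t ^ 3) + 6 * x\<^sup>2 * L (\<lambda>t. t\<^sup>2)
     - 4 * x ^ 3 * L (\<lambda>t. t) + x ^ 4"
    unfolding 3 4 by simp
qed

lemma durrmeyer_centered_moments:
  assumes "x \<in> {0..1}"
  shows "durrmeyer m (\<lambda>t. t) x - x = (1 - 2 * x) / (real m + 2)"
    "durrmeyer m (\<lambda>t. (t - x)\<^sup>2) x =
      (2 * (x * (1 - x)) * (real m - 3) + 2) / ((real m + 2) * (real m + 3))"
proof -
  interpret positive_functional "\<lambda>g. durrmeyer m g x"
    by (rule positive_functional_durrmeyer[OF assms])
  have pos: "real m + 2 \<noteq> 0" "real m + 3 \<noteq> 0" by auto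
  show "durrmeyer m (\<lambda>t. t) x - x = (1 - 2 * x) / (real m + 2)"
    unfolding durrmeyer_moments by (simp add: field_simps)
  have "((N * (N - 1) * x\<^sup>2 + 4 * N * x + 2) / ((N + 2) * (N + 3)) - 2 * x * ((N * x + 1) / (N + 2)) + x\<^sup>2)
     = (2 * (x * (1 - x)) * (N - 3) + 2) / ((N + 2) * (N + 3))" if "N + 2 \<noteq> 0" "N + 3 \<noteq> 0" for N
    using that by (simp add: divide_simps) (simp add: algebra_simps power2_eq_square)
  from this[of "real m"] show "durrmeyer m (\<lambda>t. (t - x)\<^sup>2) x =
      (2 * (x * (1 - x)) * (real m - 3) + 2) / ((real m + 2) * (real m + 3))"
    unfolding centered_moments durrmeyer_moments using pos by blast
qed

lemma genuine_BD_centered_moments: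
  assumes "x \<in> {0..1}" "n \<ge> 1"
  shows "genuine_BD n (\<lambda>t. (t - x)\<^sup>2) x = 2 * (x * (1 - x)) / (real n + 1)"
    "genuine_BD n (\<lambda>t. (t - x) ^ 4) x =
      12 * (x * (1 - x)) * ((real n - 7) * (x * (1 - x)) + 2)
        / ((real n + 1) * (real n + 2) * (real n + 3))"
proof -
  interpret positive_functional "\<lambda>g. genuine_BD n g x"
    by (rule positive_functional_genuine_BD[OF assms])
  have *: "(2 * x + (N - 1) * x\<^sup>2) / (N + 1) - 2 * x * x + x\<^sup>2 = 2 * (x * (1 - x)) / (N + 1)"
    if "N + 1 \<noteq> 0" for N
    using that by (simp add: divide_simps) (simp add: algebra_simps power2_eq_square)
  show "genuine_BD n (\<lambda>t. (t - x)\<^sup>2) x = 2 * (x * (1 - x)) / (real n + 1)"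
    unfolding centered_moments genuine_BD_moments[OF assms(2)] by (rule *) simp
  have *: "(24 * x + 36 * (N - 1) * x\<^sup>2 + 12 * (N - 1) * (N - 2) * x ^ 3 + (N - 1) * (N - 2) * (N - 3) * x ^ 4)
       / ((N + 1) * (N + 2) * (N + 3))
     - 4 * x * ((6 * x + 6 * (N - 1) * x\<^sup>2 + (N - 1) * (N - 2) * x ^ 3) / ((N + 1) * (N + 2)))
     + 6 * x\<^sup>2 * ((2 * x + (N - 1) * x\<^sup>2) / (N + 1)) - 4 * x ^ 3 * x + x ^ 4
     = 12 * (x * (1 - x)) * ((N - 7) * (x * (1 - x)) + 2) / ((N + 1) * (N + 2) * (N + 3))"
    if "N + 1 \<noteq> 0" "N + 2 \<noteq> 0" "N + 3 \<noteq> 0" for N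
    using that by (simp add: divide_simps) (simp add: algebra_simps eval_nat_numeral)
  show "genuine_BD n (\<lambda>t. (t - x) ^ 4) x =
      12 * (x * (1 - x)) * ((real n - 7) * (x * (1 - x)) + 2)
        / ((real n + 1) * (real n + 2) * (real n + 3))"
    unfolding centered_moments genuine_BD_moments[OF assms(2)] by (rule *) simp_all
qed

section \<open>Splitting the modified operator\<close>

text \<open>Pascal's rule. The modified basis is this recursion with the weights
  \<open>1 - x\<close> and \<open>x\<close> replaced by \<open>afun\<close>.\<close>

lemma Bernstein_Suc:
  "Bernstein (Suc m) k x = (1 - x) * Bernstein m k x + x * (if k = 0 then 0 else Bernstein m (k - 1) x)"
proof (cases k)
  case (Suc j)
  consider "j < m" | "j = m" | "j > m" by linarith
  then show ?thesis
  proof cases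
    case 1
    then obtain i where "m = Suc (j + i)" using less_iff_Suc_add by auto
    then show ?thesis by (simp add: Suc Bernstein_def algebra_simps)
  qed (auto simp: Suc Bernstein_def binomial_eq_0)
qed (simp add: Bernstein_def)

text \<open>Integration by parts. The derivative of \<open>Bernstein m k\<close> is \<open>m\<close>
  times a difference of two polynomials of degree \<open>m - 1\<close>, whose integrals against
  \<open>f\<close> are the inner coefficients; the boundary terms are the point values at the
  ends.\<close>

lemma genuine_coeff_diff:
  assumes f: "\<And>y. y \<in> {0..1} \<Longrightarrow> (f has_real_derivative f' y) (at y within {0..1})"
    and cont: "continuous_on {0..1} f'" and "k \<le> m"
  shows "genuine_coeff (Suc m) f (Suc k) - genuine_coeff (Suc m) f k =
    integral {0..1} (\<lambda>t. Bernstein m k t * f' t)"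
proof -
  have contf: "continuous_on {0..1} f"
    using f by (meson DERIV_continuous_on)
  define I where "I j = integral {0..1} (\<lambda>t. Bernstein (m - 1) j t * f t)" for j
  define B' where "B' t = real m * ((if k = 0 then 0 else Bernstein (m - 1) (k - 1) t) - Bernstein (m - 1) k t)" for t
  have B': "(Bernstein m k has_real_derivative B' t) (at t within {0..1})" for t
  proof (cases k)
    case 0
    then show ?thesis using has_real_derivative_Bernstein_0[of m t] by (simp add: B'_def)
  next
    case (Suc j)
    then obtain m' where "m = Suc m'" using \<open>k \<le> m\<close> by (cases m) auto
    then show ?thesis using Suc has_real_derivative_Bernstein_Suc[of m' j t]
      by (simp add: B'_def)
  qed
  have contP: "continuous_on {0..1} (\<lambda>t. if k = 0 then 0 else Bernstein (m - 1) (k - 1) t)"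
    by (cases "k = 0") (auto intro!: continuous_intros)
  have "((\<lambda>t. Bernstein m k t * f' t + B' t * f t) has_integral
      Bernstein m k 1 * f 1 - Bernstein m k 0 * f 0) {0..1}"
    by (rule fundamental_theorem_of_calculus)
       (auto simp flip: has_real_derivative_iff_has_vector_derivative intro!: DERIV_mult' B' f)
  then have "integral {0..1} (\<lambda>t. Bernstein m k t * f' t + B' t * f t) =
      Bernstein m k 1 * f 1 - Bernstein m k 0 * f 0"
    by (rule integral_unique)
  moreover have "integral {0..1} (\<lambda>t. Bernstein m k t * f' t + B' t * f t) =
      integral {0..1} (\<lambda>t. Bernstein m k t * f' t) + integral {0..1} (\<lambda>t. B' t * f t)"
    unfolding B'_def
    by (intro Henstock_Kurzweil_Integration.integral_add integrable_continuous_interval)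
       (auto intro!: continuous_intros contP cont contf)
  moreover have "integral {0..1} (\<lambda>t. B' t * f t) = real m * ((if k = 0 then 0 else I (k - 1)) - I k)"
  proof -
    have "integral {0..1} (\<lambda>t. B' t * f t) = real m * integral {0..1}
        (\<lambda>t. (if k = 0 then 0 else Bernstein (m - 1) (k - 1) t) * f t - Bernstein (m - 1) k t * f t)"
      unfolding integral_mult_right[symmetric] B'_def by (simp add: algebra_simps)
    also have "integral {0..1}
        (\<lambda>t. (if k = 0 then 0 else Bernstein (m - 1) (k - 1) t) * f t - Bernstein (m - 1) k t * f t)
        = integral {0..1} (\<lambda>t. (if k = 0 then 0 else Bernstein (m - 1) (k - 1) t) * f t) - I k"
      unfolding I_def
      by (intro Henstock_Kurzweil_Integration.integral_diff integrable_continuous_interval)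
         (auto intro!: continuous_intros contP contf)
    finally show ?thesis by (simp add: I_def)
  qed
  moreover have B01: "Bernstein m k 1 = (if k = m then 1 else 0)" "Bernstein m k 0 = (if k = 0 then 1 else 0)"
    using \<open>k \<le> m\<close> by (auto simp: Bernstein_def)
  \<comment> \<open>At \<open>k = m\<close> the coefficient is the point value alone:
    \<open>Bernstein (m - 1) m\<close> vanishes for \<open>m \<ge> 1\<close>, and for
    \<open>m = 0\<close> the factor does.\<close>
  have "real m * I m = 0" by (cases m) (auto simp: I_def Bernstein_eq_0)
  then have "genuine_coeff (Suc m) f (Suc k) = Bernstein m k 1 * f 1 + real m * I k"
    unfolding B01 by (auto simp: genuine_coeff_def I_def)
  moreover have "genuine_coeff (Suc m) f k =
      Bernstein m k 0 * f 0 + real m * (if k = 0 then 0 else I (k - 1))"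
    using \<open>k \<le> m\<close> unfolding B01 by (auto simp: genuine_coeff_def I_def)
  ultimately show ?thesis unfolding right_diff_distrib by linarith
qed

text \<open>The condition on the sequences makes the weights differ from \<open>1 - x\<close> and
  \<open>x\<close> by opposite amounts, so the correction is a multiple of the derivative of the
  Bernstein polynomial.\<close>

lemma mod_basis_eq:
  assumes "2 * a0 (Suc m) + a1 (Suc m) = 1"
  shows "mod_basis a0 a1 (Suc m) k x = Bernstein (Suc m) k x
    + (1 + a1 (Suc m)) * (x - 1 / 2)
      * (Bernstein m k x - (if k = 0 then 0 else Bernstein m (k - 1) x))"
proof -
  have a0: "a0 (Suc m) = (1 - a1 (Suc m)) / 2" using assms by simp
  have "bern_basis m (int k - 1) x = (if k = 0 then 0 else Bernstein m (k - 1) x)"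
    by (auto simp: bern_basis_def nat_diff_distrib')
  then show ?thesis
    unfolding mod_basis_def afun_def a0 Bernstein_Suc by (simp add: bern_basis_def field_simps)
qed

lemma mod_genuine_BD_eq_sum:
  "mod_genuine_BD a0 a1 (Suc m) f x =
     (\<Sum>k\<le>Suc m. mod_basis a0 a1 (Suc m) k x * genuine_coeff (Suc m) f k)"
proof -
  have "{..Suc m} = insert 0 (insert (Suc m) {1..m})" by auto
  then have "(\<Sum>k\<le>Suc m. mod_basis a0 a1 (Suc m) k x * genuine_coeff (Suc m) f k) =
      mod_basis a0 a1 (Suc m) 0 x * f 0 + mod_basis a0 a1 (Suc m) (Suc m) x * f 1
      + (\<Sum>k=1..m. mod_basis a0 a1 (Suc m) k x * genuine_coeff (Suc m) f k)"
    by (simp add: genuine_coeff_def del: sum.atMost_Suc)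
  moreover have "(\<Sum>k=1..m. mod_basis a0 a1 (Suc m) k x * genuine_coeff (Suc m) f k) =
      real m * (\<Sum>k=1..m. mod_basis a0 a1 (Suc m) k x *
        integral {0..1} (\<lambda>t. bern_basis (m - 1) (int k - 1) t * f t))"
    unfolding sum_distrib_left
    by (intro sum.cong) (auto simp: genuine_coeff_def bern_basis_def nat_diff_distrib')
  moreover have "mod_basis a0 a1 (Suc m) 0 x = afun a0 a1 x (Suc m) * (1 - x) ^ m"
    by (simp add: mod_basis_def bern_basis_def Bernstein_def)
  moreover have "mod_basis a0 a1 (Suc m) (Suc m) x = afun a0 a1 (1 - x) (Suc m) * x ^ m"
    by (simp add: mod_basis_def bern_basis_def Bernstein_def nat_add_distrib binomial_eq_0)
  ultimately show ?thesis by (simp add: mod_genuine_BD_def)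
qed

text \<open>Summation by parts moves the difference from the Bernstein polynomials to the
  coefficients, where it becomes an integral of \<open>f'\<close>. The factor \<open>n\<close> is
  exactly the normalization of the Durrmeyer operator of degree \<open>n - 1\<close>.\<close>

lemma mod_genuine_BD_decomp:
  assumes a: "2 * a0 n + a1 n = 1" and n: "n \<ge> 1"
    and f: "\<And>y. y \<in> {0..1} \<Longrightarrow> (f has_real_derivative f' y) (at y within {0..1})"
    and cont: "continuous_on {0..1} f'"
  shows "real n * mod_genuine_BD a0 a1 n f x =
    real n * genuine_BD n f x + (1 - 2 * x) / 2 * (1 + a1 n) * durrmeyer (n - 1) f' x"
proof -
  obtain m where m: "n = Suc m" using n by (cases n) auto
  define c where "c = (1 + a1 n) * (x - 1 / 2)"
  define F where "F = genuine_coeff n f"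
  have "mod_genuine_BD a0 a1 n f x =
      (\<Sum>k\<le>Suc m. (Bernstein n k x + c * (Bernstein m k x - (if k = 0 then 0 else Bernstein m (k - 1) x))) * F k)"
    using a unfolding m mod_genuine_BD_eq_sum by (simp only: mod_basis_eq c_def m F_def)
  also have "\<dots> = genuine_BD n f x
      + c * (\<Sum>k\<le>Suc m. (Bernstein m k x - (if k = 0 then 0 else Bernstein m (k - 1) x)) * F k)"
    unfolding genuine_BD_def F_def m sum_distrib_left sum.distrib[symmetric]
    by (intro sum.cong) (auto simp: algebra_simps)
  also have "(\<Sum>k\<le>Suc m. (Bernstein m k x - (if k = 0 then 0 else Bernstein m (k - 1) x)) * F k)
      = (\<Sum>k\<le>Suc m. Bernstein m k x * F k)
        - (\<Sum>k\<le>Suc m. (if k = 0 then 0 else Bernstein m (k - 1) x) * F k)"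
    by (simp only: left_diff_distrib sum_subtractf)
  also have "(\<Sum>k\<le>Suc m. (if k = 0 then 0 else Bernstein m (k - 1) x) * F k)
      = (\<Sum>k\<le>m. Bernstein m k x * F (Suc k))"
    by (subst sum.atMost_Suc_shift) simp
  also have "(\<Sum>k\<le>Suc m. Bernstein m k x * F k) = (\<Sum>k\<le>m. Bernstein m k x * F k)"
    by (simp add: Bernstein_eq_0)
  also have "(\<Sum>k\<le>m. Bernstein m k x * F k) - (\<Sum>k\<le>m. Bernstein m k x * F (Suc k))
      = - (\<Sum>k\<le>m. Bernstein m k x * (F (Suc k) - F k))"
    by (simp add: sum_subtractf right_diff_distrib)
  also have "(\<Sum>k\<le>m. Bernstein m k x * (F (Suc k) - F k)) =
      (\<Sum>k\<le>m. Bernstein m k x * integral {0..1} (\<lambda>t. Bernstein m k t * f' t))"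
  proof (rule sum.cong)
    fix k assume "k \<in> {..m}"
    then have "F (Suc k) - F k = integral {0..1} (\<lambda>t. Bernstein m k t * f' t)"
      unfolding F_def m by (intro genuine_coeff_diff f cont) auto
    then show "Bernstein m k x * (F (Suc k) - F k) =
        Bernstein m k x * integral {0..1} (\<lambda>t. Bernstein m k t * f' t)" by simp
  qed simp
  finally have "mod_genuine_BD a0 a1 n f x = genuine_BD n f x
      - c * (\<Sum>k\<le>m. Bernstein m k x * integral {0..1} (\<lambda>t. Bernstein m k t * f' t))"
    by simp
  then have "real n * mod_genuine_BD a0 a1 n f x = real n * genuine_BD n f x
      - c * (real n * (\<Sum>k\<le>m. Bernstein m k x * integral {0..1} (\<lambda>t. Bernstein m k t * f' t)))"
    by (simp only: right_diff_distrib mult.left_commute)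
  also have "real n * (\<Sum>k\<le>m. Bernstein m k x * integral {0..1} (\<lambda>t. Bernstein m k t * f' t))
      = durrmeyer (n - 1) f' x"
    by (simp add: durrmeyer_def m sum_distrib_left mult_ac del: of_nat_Suc)
  finally show ?thesis by (simp add: c_def field_simps)
qed

section \<open>Quantitative estimates\<close>

lemma continuous_on_01_bounded:
  fixes g :: "real \<Rightarrow> real"
  assumes "continuous_on {0..1} g"
  obtains M where "\<And>t. t \<in> {0..1} \<Longrightarrow> \<bar>g t\<bar> \<le> M"
proof -
  have "bounded (g ` {0..1})"
    using assms by (intro compact_imp_bounded compact_continuous_image) auto
  then obtain M where "\<forall>y\<in>g ` {0..1}. norm y \<le> M" using bounded_iff by blast
  then show thesis using that[of M] by auto
qed

text \<open>Continuity enters through boundedness, which makes the real-valued \<open>Sup\<close> an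
  upper bound.\<close>

lemma abs_diff_le_modulus1:
  fixes g :: "real \<Rightarrow> real"
  assumes "continuous_on {0..1} g" "p \<in> {0..1}" "q \<in> {0..1}" "\<bar>p - q\<bar> \<le> \<delta>"
  shows "\<bar>g p - g q\<bar> \<le> modulus1 g \<delta>"
proof -
  obtain M where M: "\<And>t. t \<in> {0..1} \<Longrightarrow> \<bar>g t\<bar> \<le> M"
    using continuous_on_01_bounded[OF assms(1)] by blast
  have "bdd_above {\<bar>g s - g t\<bar> | s t. s \<in> {0..1} \<and> t \<in> {0..1} \<and> \<bar>s - t\<bar> \<le> \<delta>}"
  proof (rule bdd_aboveI[of _ "2 * M"], clarify)
    fix s t assume "s \<in> {0..1::real}" "t \<in> {0..1::real}"
    then show "\<bar>g s - g t\<bar> \<le> 2 * M" using M[of s] M[of t] by linarith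
  qed
  then show ?thesis unfolding modulus1_def
    by (rule cSup_upper[rotated]) (use assms in blast)
qed

lemma abs_diff2_le_modulus2:
  fixes g :: "real \<Rightarrow> real"
  assumes "continuous_on {0..1} g" "0 \<le> d" "d \<le> \<delta>" "0 \<le> y - d" "y + d \<le> 1"
  shows "\<bar>g (y - d) - 2 * g y + g (y + d)\<bar> \<le> modulus2 g \<delta>"
proof -
  obtain M where M: "\<And>t. t \<in> {0..1} \<Longrightarrow> \<bar>g t\<bar> \<le> M"
    using continuous_on_01_bounded[OF assms(1)] by blast
  have "bdd_above {\<bar>g (t - h) - 2 * g t + g (t + h)\<bar> | t h.
            0 \<le> h \<and> h \<le> \<delta> \<and> t - h \<in> {0..1} \<and> t + h \<in> {0..1}}"
  proof (rule bdd_aboveI[of _ "4 * M"], clarify)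
    fix t h assume "0 \<le> h" "t - h \<in> {0..1::real}" "t + h \<in> {0..1}"
    then show "\<bar>g (t - h) - 2 * g t + g (t + h)\<bar> \<le> 4 * M"
      using M[of "t - h"] M[of t] M[of "t + h"] by auto
  qed
  then show ?thesis unfolding modulus2_def
    by (rule cSup_upper[rotated]) (use assms in force)
qed

lemma abs_le_sup_norm01:
  fixes g :: "real \<Rightarrow> real"
  assumes "continuous_on {0..1} g" "t \<in> {0..1}"
  shows "\<bar>g t\<bar> \<le> sup_norm01 g"
proof -
  have "compact ((\<lambda>t. \<bar>g t\<bar>) ` {0..1})"
    using assms(1) by (intro compact_continuous_image continuous_intros) auto
  then show ?thesis unfolding sup_norm01_def
    by (intro cSUP_upper assms(2)) (auto intro: bounded_imp_bdd_above compact_imp_bounded)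
qed

section \<open>Taylor expansion and second differences\<close>

lemma mvt_unordered:
  fixes F F' :: "real \<Rightarrow> real"
  assumes F: "\<And>y. y \<in> {0..1} \<Longrightarrow> (F has_real_derivative F' y) (at y within {0..1})"
    and ab: "a \<in> {0..1}" "b \<in> {0..1}"
  obtains \<xi> where "\<xi> \<in> closed_segment a b" "F b - F a = F' \<xi> * (b - a)"
proof -
  have *: "\<exists>\<xi>\<in>{a..b}. F b - F a = F' \<xi> * (b - a)" if "a \<le> b" "a \<in> {0..1}" "b \<in> {0..1}" for a b
  proof (rule mvt_very_simple[OF \<open>a \<le> b\<close>])
    fix y assume y: "a \<le> y" "y \<le> b"
    then have "(F has_real_derivative F' y) (at y within {a..b})"
      using that by (intro has_field_derivative_subset[OF F]) auto
    then show "(F has_derivative (*) (F' y)) (at y within {a..b})"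
      by (simp add: has_field_derivative_def)
  qed
  show thesis
  proof (cases "a \<le> b")
    case True
    then show thesis using *[of a b] ab that by (auto simp: closed_segment_eq_real_ivl)
  next
    case False
    then obtain \<xi> where "\<xi> \<in> {b..a}" "F a - F b = F' \<xi> * (a - b)"
      using *[of b a] ab by auto
    then show thesis using that[of \<xi>] False by (auto simp: closed_segment_eq_real_ivl algebra_simps)
  qed
qed

text \<open>The mean value theorem is applied to the remainder and then to \<open>f'\<close>; this
  gives up a factor 1/2. The constant \<open>c\<close> is free so that it can be the value of
  \<open>f''\<close> at a point other than \<open>a\<close>.\<close>

lemma taylor2_mvt:
  fixes f f' f'' :: "real \<Rightarrow> real"
  assumes f: "\<And>y. y \<in> {0..1} \<Longrightarrow> (f has_real_derivative f' y) (at y within {0..1})"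
    and f': "\<And>y. y \<in> {0..1} \<Longrightarrow> (f' has_real_derivative f'' y) (at y within {0..1})"
    and ab: "a \<in> {0..1}" "b \<in> {0..1}"
  obtains \<xi> where "\<xi> \<in> closed_segment a b"
    "\<bar>f b - f a - f' a * (b - a) - c / 2 * (b - a)\<^sup>2\<bar> \<le> \<bar>f'' \<xi> - c\<bar> * (b - a)\<^sup>2"
proof -
  define r where "r s = f s - f a - f' a * (s - a) - c / 2 * (s - a)\<^sup>2" for s
  have r: "(r has_real_derivative (f' s - f' a - c * (s - a))) (at s within {0..1})"
    if "s \<in> {0..1}" for s
    unfolding r_def[abs_def]
    by (rule derivative_eq_intros f that refl | simp)+
  obtain \<zeta> where z: "\<zeta> \<in> closed_segment a b" "r b - r a = (f' \<zeta> - f' a - c * (\<zeta> - a)) * (b - a)"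
    using mvt_unordered[OF r ab] by auto
  have z01: "\<zeta> \<in> {0..1}" using z ab by (auto simp: closed_segment_eq_real_ivl split: if_splits)
  obtain \<xi> where x: "\<xi> \<in> closed_segment a \<zeta>" "f' \<zeta> - f' a = f'' \<xi> * (\<zeta> - a)"
    using mvt_unordered[OF f' ab(1) z01] by auto
  have "\<bar>\<zeta> - a\<bar> \<le> \<bar>b - a\<bar>"
    using z(1) by (auto simp: closed_segment_eq_real_ivl split: if_splits)
  then have "\<bar>\<zeta> - a\<bar> * \<bar>b - a\<bar> \<le> \<bar>b - a\<bar> * \<bar>b - a\<bar>" by (rule mult_right_mono) simp
  then have "\<bar>\<zeta> - a\<bar> * \<bar>b - a\<bar> \<le> (b - a)\<^sup>2" by (simp add: power2_eq_square)
  moreover have "r b = (f'' \<xi> - c) * ((\<zeta> - a) * (b - a))"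
    using z(2) x(2) by (simp add: r_def algebra_simps)
  ultimately have "\<bar>r b\<bar> \<le> \<bar>f'' \<xi> - c\<bar> * (b - a)\<^sup>2"
    by (simp add: abs_mult mult_left_mono)
  moreover have "\<xi> \<in> closed_segment a b"
    using x(1) z(1) by (auto simp: closed_segment_eq_real_ivl split: if_splits)
  ultimately show thesis using that by (simp add: r_def)
qed

text \<open>A second difference with step \<open>d\<close> equals \<open>f'' x * d\<^sup>2\<close>
  up to two Taylor remainders. Each is at most \<open>2 * W * d\<^sup>2\<close>, as one passes from
  \<open>\<xi>\<close> to \<open>x\<close> through the centre \<open>t\<close>.\<close>

lemma second_derivative_le_modulus2:
  fixes f f' f'' :: "real \<Rightarrow> real"
  assumes f: "\<And>y. y \<in> {0..1} \<Longrightarrow> (f has_real_derivative f' y) (at y within {0..1})"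
    and f': "\<And>y. y \<in> {0..1} \<Longrightarrow> (f' has_real_derivative f'' y) (at y within {0..1})"
    and W: "\<And>p q. p \<in> {0..1} \<Longrightarrow> q \<in> {0..1} \<Longrightarrow> \<bar>p - q\<bar> \<le> h \<Longrightarrow> \<bar>f'' p - f'' q\<bar> \<le> W"
    and x: "x \<in> {0..1}" and d: "0 < d" "d \<le> h" "d \<le> 1 / 2" "d \<le> \<delta>"
  shows "\<bar>f'' x\<bar> * d\<^sup>2 \<le> modulus2 f \<delta> + 4 * W * d\<^sup>2"
proof -
  \<comment> \<open>The point of \<open>[d, 1 - d]\<close> nearest to \<open>x\<close>, so that the
    second difference stays in the unit interval; \<open>d \<le> 1 / 2\<close> makes this
    possible.\<close>
  define t where "t = max d (min x (1 - d))"
  have t: "0 \<le> t - d" "t + d \<le> 1" "t \<in> {0..1}" "\<bar>t - x\<bar> \<le> d"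
    using d x by (auto simp: t_def)
  have W2: "\<bar>f'' \<xi> - f'' x\<bar> \<le> 2 * W" if xi: "\<xi> \<in> {0..1}" "\<bar>\<xi> - t\<bar> \<le> d" for \<xi>
    using W[of \<xi> t] W[of t x] that t x d by auto
  define r where "r b = f b - f t - f' t * (b - t) - f'' x / 2 * (b - t)\<^sup>2" for b
  have r: "\<bar>r b\<bar> \<le> 2 * W * d\<^sup>2" if b: "b = t - d \<or> b = t + d" for b
  proof -
    have b01: "b \<in> {0..1}" using b t d by auto
    obtain \<xi> where xi: "\<xi> \<in> closed_segment t b"
      "\<bar>f b - f t - f' t * (b - t) - f'' x / 2 * (b - t)\<^sup>2\<bar> \<le> \<bar>f'' \<xi> - f'' x\<bar> * (b - t)\<^sup>2"
      using taylor2_mvt[OF f f' t(3) b01, where c = "f'' x"] by auto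
    have "(b - t)\<^sup>2 = d\<^sup>2" using b by auto
    moreover have "\<bar>f'' \<xi> - f'' x\<bar> \<le> 2 * W"
      using xi(1) b d t by (intro W2) (auto simp: closed_segment_eq_real_ivl split: if_splits)
    then have "\<bar>f'' \<xi> - f'' x\<bar> * d\<^sup>2 \<le> 2 * W * d\<^sup>2" by (intro mult_right_mono) auto
    ultimately show ?thesis using xi(2) by (simp add: r_def)
  qed
  have "f (t - d) - 2 * f t + f (t + d) = f'' x * d\<^sup>2 + r (t - d) + r (t + d)"
    by (simp add: r_def algebra_simps)
  moreover have "\<bar>f (t - d) - 2 * f t + f (t + d)\<bar> \<le> modulus2 f \<delta>"
    using t d by (intro abs_diff2_le_modulus2 DERIV_continuous_on[OF f]) auto
  moreover have "\<bar>f'' x\<bar> * d\<^sup>2 = \<bar>f'' x * d\<^sup>2\<bar>" by (simp add: abs_mult)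
  ultimately show ?thesis using r[of "t - d"] r[of "t + d"] by linarith
qed

section \<open>The Voronovskaja estimate for the genuine operator\<close>

lemma mult_one_minus_le_quarter:
  fixes x :: real
  shows "x * (1 - x) \<le> 1 / 4"
  using zero_le_power2[of "x - 1 / 2"] by (simp add: power2_eq_square algebra_simps)

text \<open>The remainder costs \<open>4 * X * n / (n + 1)\<close> times \<open>W\<close>. The
  second moment leaves the defect \<open>X * f'' x / (n + 1)\<close>, which costs a further
  \<open>4 * X / (n + 1)\<close> times \<open>W\<close> and \<open>2 * X * B\<close>. The parts add
  up to \<open>4 * X * W + 2 * X * B\<close>, and \<open>X \<le> 1 / 4\<close>.\<close>

lemma genuine_BD_voronovskaja:
  fixes f f' f'' :: "real \<Rightarrow> real"
  assumes f: "\<And>y. y \<in> {0..1} \<Longrightarrow> (f has_real_derivative f' y) (at y within {0..1})"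
    and f': "\<And>y. y \<in> {0..1} \<Longrightarrow> (f' has_real_derivative f'' y) (at y within {0..1})"
    and cont: "continuous_on {0..1} f''"
    and x: "x \<in> {0..1}" and n: "n \<ge> 1"
  shows "\<bar>real n * (genuine_BD n f x - f x) - x * (1 - x) * f'' x\<bar>
    \<le> modulus1 f'' (sqrt (3 / (real n + 2))) + 1 / 2 * modulus2 f (sqrt (2 / (real n + 1)))"
proof -
  interpret positive_functional "\<lambda>g. genuine_BD n g x"
    by (rule positive_functional_genuine_BD[OF x n])
  define h where "h = sqrt (3 / (real n + 2))"
  define \<delta> where "\<delta> = sqrt (2 / (real n + 1))"
  define W where "W = modulus1 f'' h"
  define B where "B = modulus2 f \<delta>"
  define X where "X = x * (1 - x)"
  have h: "h > 0" "h\<^sup>2 = 3 / (real n + 2)" by (auto simp: h_def)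
  have contf: "continuous_on {0..1} f" using f by (meson DERIV_continuous_on)
  have X: "0 \<le> X" "X \<le> 1 / 4" using x mult_one_minus_le_quarter[of x] by (auto simp: X_def)
  have W: "\<bar>f'' p - f'' q\<bar> \<le> W" if "p \<in> {0..1}" "q \<in> {0..1}" "\<bar>p - q\<bar> \<le> h" for p q
    unfolding W_def by (intro abs_diff_le_modulus1 cont that)
  have W0: "W \<ge> 0" using W[of 0 0] h by simp
  have B0: "B \<ge> 0"
    using abs_diff2_le_modulus2[OF contf, of 0 \<delta> 0] by (simp add: B_def \<delta>_def)
  define R where "R t = f t - f x - f' x * (t - x) - f'' x / 2 * (t - x)\<^sup>2" for t
  have R: "\<bar>R t\<bar> \<le> W * ((t - x)\<^sup>2 + 1 / h\<^sup>2 * (t - x) ^ 4)" if t: "t \<in> {0..1}" for t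
  proof -
    obtain \<xi> where xi: "\<xi> \<in> closed_segment x t"
      "\<bar>f t - f x - f' x * (t - x) - f'' x / 2 * (t - x)\<^sup>2\<bar> \<le> \<bar>f'' \<xi> - f'' x\<bar> * (t - x)\<^sup>2"
      using taylor2_mvt[OF f f' x t, where c = "f'' x"] by auto
    have xi01: "\<xi> \<in> {0..1}" "\<bar>\<xi> - x\<bar> \<le> \<bar>t - x\<bar>"
      using xi(1) x t by (auto simp: closed_segment_eq_real_ivl split: if_splits)
    have "\<bar>f'' \<xi> - f'' x\<bar> \<le> (1 + (\<xi> - x)\<^sup>2 / h\<^sup>2) * W"
      by (rule increment_le_square[OF W]) (use xi01 x h in auto)
    also have "\<dots> \<le> (1 + (t - x)\<^sup>2 / h\<^sup>2) * W"
      using xi01(2) W0 h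
      by (intro mult_right_mono add_left_mono divide_right_mono) (auto simp: abs_le_square_iff)
    finally have "\<bar>f'' \<xi> - f'' x\<bar> * (t - x)\<^sup>2 \<le> (1 + (t - x)\<^sup>2 / h\<^sup>2) * W * (t - x)\<^sup>2"
      by (intro mult_right_mono) auto
    also have "\<dots> = W * ((t - x)\<^sup>2 + 1 / h\<^sup>2 * (t - x) ^ 4)"
    proof -
      have "(1 + a / h\<^sup>2) * W * a = W * (a + 1 / h\<^sup>2 * a\<^sup>2)" for a
        by (simp add: algebra_simps power2_eq_square)
      from this[of "(t - x)\<^sup>2"] show ?thesis by simp
    qed
    finally show ?thesis using xi(2) by (simp add: R_def)
  qed
  have V1: "genuine_BD n (\<lambda>t. t) x = x" by (rule genuine_BD_moments[OF n])
  define V2 where "V2 = genuine_BD n (\<lambda>t. (t - x)\<^sup>2) x"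
  define V4 where "V4 = genuine_BD n (\<lambda>t. (t - x) ^ 4) x"
  have V2: "V2 = 2 * X / (real n + 1)"
    and V4: "V4 = 12 * X * ((real n - 7) * X + 2) / ((real n + 1) * (real n + 2) * (real n + 3))"
    unfolding V2_def V4_def X_def by (rule genuine_BD_centered_moments[OF x n])+
  have LR: "genuine_BD n R x = genuine_BD n f x - f x - f'' x / 2 * V2"
  proof -
    have "genuine_BD n R x = genuine_BD n (\<lambda>t. f t - (f x + (f' x * t + (- f' x * x + f'' x / 2 * (t - x)\<^sup>2)))) x"
      by (rule arg_cong[of _ _ "\<lambda>g. genuine_BD n g x"]) (auto simp: R_def algebra_simps)
    also have "\<dots> = genuine_BD n f x - (f x + (f' x * x + (- f' x * x + f'' x / 2 * V2)))"
      by (simp only: diff add scale const V1 V2_def[symmetric] contf continuous_intros)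
    finally show ?thesis by simp
  qed
  have "\<bar>genuine_BD n R x\<bar> \<le> genuine_BD n (\<lambda>t. W * ((t - x)\<^sup>2 + 1 / h\<^sup>2 * (t - x) ^ 4)) x"
    by (rule abs_le) (use R contf h(1) in \<open>auto intro!: continuous_intros simp: R_def[abs_def]\<close>)
  also have "\<dots> = W * (V2 + 1 / h\<^sup>2 * V4)"
    by (simp only: add scale V2_def[symmetric] V4_def[symmetric] continuous_intros)
  finally have LRb: "\<bar>genuine_BD n R x\<bar> \<le> W * (V2 + 1 / h\<^sup>2 * V4)" .
  have V: "real n * (V2 + 1 / h\<^sup>2 * V4) \<le> 4 * X * real n / (real n + 1)"
  proof -
    \<comment> \<open>The choice of \<open>h\<close> cancels the factor \<open>n + 2\<close> in the
      fourth moment.\<close>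
    have eq: "real n * (V2 + 1 / h\<^sup>2 * V4) =
        2 * X * real n / (real n + 1) * (1 + 2 * ((real n - 7) * X + 2) / (real n + 3))"
    proof -
      have "N * (2 * X / (N + 1) + 1 / (3 / (N + 2)) * (12 * X * Y / ((N + 1) * (N + 2) * (N + 3))))
          = 2 * X * N / (N + 1) * (1 + 2 * Y / (N + 3))" if "N \<ge> 0" for N Y :: real
        using that by (simp add: divide_simps) (simp add: algebra_simps)
      from this[OF of_nat_0_le_iff] show ?thesis unfolding V2 V4 h .
    qed
    have "2 * ((real n - 7) * X + 2) \<le> real n + 3"
    proof -
      \<comment> \<open>Since \<open>n - 7\<close> may be negative, \<open>X \<le> 1 / 4\<close> is
        applied only to the part with factor \<open>n - 1\<close>.\<close>
      have "(real n - 7) * X = (real n - 1) * X - 6 * X" by (simp add: algebra_simps)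
      moreover have "(real n - 1) * X \<le> (real n - 1) * (1 / 4)" using n X by (intro mult_left_mono) auto
      ultimately show ?thesis using n X by (simp add: algebra_simps)
    qed
    then have "1 + 2 * ((real n - 7) * X + 2) / (real n + 3) \<le> 2" by (simp add: divide_le_eq)
    then have "2 * X * real n / (real n + 1) * (1 + 2 * ((real n - 7) * X + 2) / (real n + 3))
        \<le> 2 * X * real n / (real n + 1) * 2"
      using X by (intro mult_left_mono) auto
    then show ?thesis unfolding eq by simp
  qed
  \<comment> \<open>The step is capped so that it fits into the unit interval; the cap costs at most
    a factor 4 in \<open>d\<^sup>2\<close>.\<close>
  define d where "d = min \<delta> (1 / 2)"
  have d: "0 < d" "d \<le> \<delta>" "d \<le> 1 / 2" by (auto simp: d_def \<delta>_def)
  have "\<delta> \<le> h" unfolding \<delta>_def h_def using n by (auto simp: divide_simps)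
  have d2: "1 / (2 * (real n + 1)) \<le> d\<^sup>2"
  proof (cases "\<delta> \<le> 1 / 2")
    case True
    then show ?thesis by (simp add: d_def \<delta>_def min_def divide_simps)
  next
    case False
    then show ?thesis using n by (simp add: d_def min_def divide_simps power2_eq_square)
  qed
  have "\<bar>f'' x\<bar> * d\<^sup>2 \<le> B + 4 * W * d\<^sup>2"
    unfolding B_def
    by (rule second_derivative_le_modulus2[OF f f' W x]) (use d \<open>\<delta> \<le> h\<close> in auto)
  then have "(\<bar>f'' x\<bar> - 4 * W) * d\<^sup>2 \<le> B" by (simp add: algebra_simps)
  \<comment> \<open>The lower bound on \<open>d\<^sup>2\<close> helps only if
    \<open>\<bar>f'' x\<bar> - 4 * W\<close> is nonnegative; otherwise \<open>B \<ge> 0\<close>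
    suffices.\<close>
  moreover have "(\<bar>f'' x\<bar> - 4 * W) * (1 / (2 * (real n + 1))) \<le> max 0 ((\<bar>f'' x\<bar> - 4 * W) * d\<^sup>2)"
    using mult_left_mono[OF d2, of "\<bar>f'' x\<bar> - 4 * W"]
    by (cases "\<bar>f'' x\<bar> - 4 * W \<ge> 0") (auto simp: le_max_iff_disj divide_le_0_iff)
  ultimately have "(\<bar>f'' x\<bar> - 4 * W) * (1 / (2 * (real n + 1))) \<le> B" using B0 by simp
  then have "\<bar>f'' x\<bar> / (real n + 1) \<le> 2 * B + 4 * W / (real n + 1)"
    by (simp add: divide_simps) (simp add: algebra_simps)
  from mult_left_mono[OF this X(1)]
  have c: "X * \<bar>f'' x\<bar> / (real n + 1) \<le> 2 * X * B + 4 * X * W / (real n + 1)"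
    by (simp add: algebra_simps)
  have "real n * (genuine_BD n f x - f x) - X * f'' x =
      real n * genuine_BD n R x - X * f'' x / (real n + 1)"
  proof -
    have "real n * (f'' x / 2 * V2) - X * f'' x = - (X * f'' x / (real n + 1))"
      unfolding V2 by (simp add: divide_simps) (simp add: algebra_simps)
    then show ?thesis unfolding LR by (simp add: algebra_simps)
  qed
  moreover have "\<bar>real n * genuine_BD n R x\<bar> \<le> W * (4 * X * real n / (real n + 1))"
  proof -
    have "\<bar>real n * genuine_BD n R x\<bar> \<le> real n * (W * (V2 + 1 / h\<^sup>2 * V4))"
      using LRb by (simp add: abs_mult mult_left_mono)
    also have "\<dots> = W * (real n * (V2 + 1 / h\<^sup>2 * V4))" by simp
    also have "\<dots> \<le> W * (4 * X * real n / (real n + 1))"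
      by (rule mult_left_mono[OF V W0])
    finally show ?thesis .
  qed
  moreover have "\<bar>X * f'' x / (real n + 1)\<bar> = X * \<bar>f'' x\<bar> / (real n + 1)"
    using X by (simp add: abs_mult)
  ultimately have "\<bar>real n * (genuine_BD n f x - f x) - X * f'' x\<bar>
      \<le> W * (4 * X * real n / (real n + 1)) + (2 * X * B + 4 * X * W / (real n + 1))"
    using c by linarith
  also have "\<dots> = 4 * X * W + 2 * X * B" by (simp add: divide_simps) (simp add: algebra_simps)
  also have "\<dots> \<le> 1 * W + 1 / 2 * B" using X W0 B0 by (intro add_mono mult_right_mono) auto
  finally show ?thesis by (simp add: X_def W_def B_def h_def \<delta>_def)
qed

text \<open>The first moment \<open>u * h\<^sup>2\<close> divided by \<open>h\<close> gives the
  factor \<open>h\<close> of \<open>W\<close>, and the second moment adds 1/4 to the factor 1 of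
  \<open>B\<close>. The weight \<open>\<bar>1 - 2 * x\<bar>\<close> is bounded by 1 if an interval
  of length \<open>h\<close> fits beside \<open>x\<close>; otherwise its smallness compensates the
  crude bound \<open>W\<close>.\<close>

lemma durrmeyer_estimate:
  fixes g :: "real \<Rightarrow> real"
  assumes cont: "continuous_on {0..1} g" and x: "x \<in> {0..1}" and n: "n \<ge> 1"
  shows "\<bar>1 - 2 * x\<bar> * \<bar>durrmeyer (n - 1) g x - g x\<bar>
    \<le> 1 / sqrt (real n + 1) * modulus1 g (1 / sqrt (real n + 1))
      + 5 / 4 * modulus2 g (1 / sqrt (real n + 1))"
proof -
  interpret positive_functional "\<lambda>g. durrmeyer (n - 1) g x"
    by (rule positive_functional_durrmeyer[OF x])
  define h where "h = 1 / sqrt (real n + 1)"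
  define W where "W = modulus1 g h"
  define B where "B = modulus2 g h"
  define u where "u = \<bar>1 - 2 * x\<bar>"
  define D where "D = \<bar>durrmeyer (n - 1) g x - g x\<bar>"
  have u: "0 \<le> u" "u \<le> 1" using x by (auto simp: u_def)
  have h: "0 < h" "h \<le> 1" "h\<^sup>2 = 1 / (real n + 1)" by (auto simp: h_def power_divide)
  have W: "\<bar>g p - g q\<bar> \<le> W" if "p \<in> {0..1}" "q \<in> {0..1}" "\<bar>p - q\<bar> \<le> h" for p q
    unfolding W_def by (intro abs_diff_le_modulus1 cont that)
  have W0: "W \<ge> 0" using W[of 0 0] h by simp
  have diff2: "\<bar>g (y - d) - 2 * g y + g (y + d)\<bar> \<le> B"
    if "0 \<le> d" "d \<le> h" "0 \<le> y - d" "y + d \<le> 1" for y d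
    unfolding B_def by (intro abs_diff2_le_modulus2 cont that)
  have B0: "B \<ge> 0" using diff2[of 0 0] h by simp
  have "u * D \<le> h * W + 5 / 4 * B"
  proof (cases "x + h \<le> 1 \<or> h \<le> x")
    case room: True
    text \<open>For \<open>n = 1\<close> all second differences on \<open>[0,1]\<close> have step at most \<open>1/2 < h\<close>, so a larger
      \<open>\<eta>\<close> is available; \<open>\<eta> = h\<close> would give the factor \<open>4/3\<close> at the endpoints.\<close>
    define \<eta> where "\<eta> = (if n = 1 then 1 else h)"
    have eta: "\<eta> > 0" "h \<le> 2 * \<eta>" using h by (auto simp: \<eta>_def)
    have diff2': "\<bar>g (y - d) - 2 * g y + g (y + d)\<bar> \<le> B"
      if d: "0 \<le> d" "d \<le> \<eta>" "0 \<le> y - d" "y + d \<le> 1" for y d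
    proof (rule diff2)
      show "d \<le> h"
      proof (cases "n = 1")
        case True
        have "sqrt 2 \<le> 2" by (simp add: real_sqrt_le_iff' )
        then have "1 / 2 \<le> h" using True by (simp add: h_def divide_simps)
        then show ?thesis using d by linarith
      qed (use d in \<open>simp add: \<eta>_def\<close>)
    qed (use d in auto)
    have n1: "real (n - 1) = real n - 1" using n by simp
    have M1: "\<bar>durrmeyer (n - 1) (\<lambda>t. t) x - x\<bar> = u * h\<^sup>2"
      unfolding durrmeyer_centered_moments[OF x] n1 h u_def by simp
    have M2: "durrmeyer (n - 1) (\<lambda>t. (t - x)\<^sup>2) x =
        (2 * (x * (1 - x)) * (real n - 4) + 2) / ((real n + 1) * (real n + 2))"
      unfolding durrmeyer_centered_moments[OF x] n1 by (simp add: algebra_simps)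
    have X: "0 \<le> x * (1 - x)" "x * (1 - x) \<le> 1 / 4" using x mult_one_minus_le_quarter[of x] by auto
    have M2': "durrmeyer (n - 1) (\<lambda>t. (t - x)\<^sup>2) x / (2 * \<eta>\<^sup>2) \<le> 1 / 4"
    proof (cases "n = 1")
      case True
      then show ?thesis unfolding M2 \<eta>_def using X by simp
    next
      case False
      then have n2: "n \<ge> 2" using n by simp
      \<comment> \<open>For \<open>n \<ge> 4\<close> this follows from
        \<open>4 * x * (1 - x) \<le> 1\<close>; for \<open>n = 2\<close> and \<open>n = 3\<close>
        the first term is nonpositive. At \<open>n = 1\<close> it fails at the endpoints.\<close>
      have "4 * (x * (1 - x)) * (real n - 4) + 4 \<le> real n + 2"
      proof (cases "n \<ge> 4")
        case True
        then have "4 * (x * (1 - x)) * (real n - 4) \<le> 1 * (real n - 4)"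
          using X by (intro mult_right_mono) auto
        then show ?thesis by simp
      next
        case False
        then have "n = 2 \<or> n = 3" using n2 by auto
        then show ?thesis using X by auto
      qed
      moreover have "durrmeyer (n - 1) (\<lambda>t. (t - x)\<^sup>2) x / (2 * \<eta>\<^sup>2) =
          ((x * (1 - x)) * (real n - 4) + 1) / (real n + 2)"
        unfolding M2 using False by (simp add: \<eta>_def h divide_simps) (simp add: algebra_simps)
      ultimately show ?thesis by (simp add: divide_le_eq)
    qed
    have "D \<le> W / h * \<bar>durrmeyer (n - 1) (\<lambda>t. t) x - x\<bar>
        + B * (1 + durrmeyer (n - 1) (\<lambda>t. (t - x)\<^sup>2) x / (2 * \<eta>\<^sup>2))"
      unfolding D_def
      by (rule modulus_estimate[OF cont eta(1) B0 diff2' W h(1) eta(2)]) (use x room in auto)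
    also have "\<dots> \<le> W * h * u + B * (5 / 4)"
      using M2' B0 h(1) unfolding M1
      by (intro add_mono mult_left_mono) (auto simp: power2_eq_square)
    also have "\<dots> \<le> h * W + 5 / 4 * B"
      using u W0 h(1) mult_left_mono[of u 1 "W * h"] by (simp add: mult_ac)
    finally have "D \<le> h * W + 5 / 4 * B" .
    moreover have "u * D \<le> 1 * D" using u by (intro mult_right_mono) (auto simp: D_def)
    ultimately show ?thesis by simp
  next
    case False
    text \<open>Now \<open>h > 1/2\<close> and \<open>\<bar>1 - 2 x\<bar> < 2 h - 1 \<le> h\<close>, while all of \<open>[0,1]\<close> is within \<open>h\<close> of \<open>x\<close>.\<close>
    have "\<bar>durrmeyer (n - 1) (\<lambda>t. g t - g x) x\<bar> \<le> W"
    proof (rule abs_le_const)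
      show "\<bar>g t - g x\<bar> \<le> W" if "t \<in> {0..1}" for t
        using that x False by (intro W) auto
    qed (intro continuous_intros cont)
    then have "D \<le> W" unfolding D_def using diff[OF cont, of "\<lambda>t. g x"] const by simp
    moreover have "u \<le> h" using False h(2) by (auto simp: u_def)
    ultimately have "u * D \<le> h * W" using u h by (intro mult_mono) (auto simp: D_def)
    then show ?thesis using B0 by simp
  qed
  then show ?thesis by (simp add: u_def D_def h_def W_def B_def)
qed

section \<open>Assembly of the estimate\<close>

theorem theorem8p2:
  fixes a0 a1 :: "nat \<Rightarrow> real" and L1 :: real
    and f f' f'' :: "real \<Rightarrow> real" and x :: real and n :: nat
  assumes "\<And>m. m \<ge> 1 \<Longrightarrow> 2 * a0 m + a1 m = 1"
    and "\<And>y. y \<in> {0..1} \<Longrightarrow> (f has_real_derivative f' y) (at y within {0..1})"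
    and "\<And>y. y \<in> {0..1} \<Longrightarrow> (f' has_real_derivative f'' y) (at y within {0..1})"
    and "continuous_on {0..1} f''"
    and "a1 \<longlonglongrightarrow> L1"
    and "x \<in> {0..1}"
    and "n \<ge> 1"
  shows "\<bar>real n * (mod_genuine_BD a0 a1 n f x - f x) - x * (1 - x) * f'' x
            - (1 - 2 * x) / 2 * (1 + L1) * f' x\<bar>
    \<le> 5 * sqrt 6 / 12 * modulus1 f'' (sqrt (3 / (real n + 2)))
      + 13 / 32 * modulus2 f'' (sqrt (3 / (real n + 2)))
      + 9 / 8 * modulus2 f (sqrt (2 / (real n + 1)))
      + 1 / 2 * (\<bar>L1 - a1 n\<bar> * sup_norm01 f'
          + \<bar>1 + L1\<bar> * (1 / sqrt (real n + 1) * modulus1 f' (1 / sqrt (real n + 1))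
              + 5 / 4 * modulus2 f' (1 / sqrt (real n + 1))))"
proof -
  note f = assms(2) and f' = assms(3) and cont = assms(4) and x = assms(6) and n = assms(7)
  have contf: "continuous_on {0..1} f" by (rule DERIV_continuous_on[OF f])
  have contf': "continuous_on {0..1} f'" by (rule DERIV_continuous_on[OF f'])
  interpret M: positive_functional "\<lambda>g. durrmeyer (n - 1) g x"
    by (rule positive_functional_durrmeyer[OF x])
  define D where "D = durrmeyer (n - 1) f' x"
  define S where "S = sup_norm01 f'"
  define E where "E = 1 / sqrt (real n + 1) * modulus1 f' (1 / sqrt (real n + 1))
      + 5 / 4 * modulus2 f' (1 / sqrt (real n + 1))"
  define W where "W = modulus1 f'' (sqrt (3 / (real n + 2)))"
  define W2 where "W2 = modulus2 f'' (sqrt (3 / (real n + 2)))"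
  define B where "B = modulus2 f (sqrt (2 / (real n + 1)))"
  define V where "V = real n * (genuine_BD n f x - f x) - x * (1 - x) * f'' x"
  have W0: "W \<ge> 0"
    using abs_diff_le_modulus1[OF cont, of 0 0 "sqrt (3 / (real n + 2))"] by (simp add: W_def)
  have W20: "W2 \<ge> 0"
    using abs_diff2_le_modulus2[OF cont, of 0 "sqrt (3 / (real n + 2))" 0] by (simp add: W2_def)
  have B0: "B \<ge> 0"
    using abs_diff2_le_modulus2[OF contf, of 0 "sqrt (2 / (real n + 1))" 0] by (simp add: B_def)
  have S: "\<bar>D\<bar> \<le> S"
    unfolding D_def S_def by (intro M.abs_le_const contf' abs_le_sup_norm01)
  have E: "\<bar>1 - 2 * x\<bar> * \<bar>D - f' x\<bar> \<le> E"
    unfolding D_def E_def by (rule durrmeyer_estimate[OF contf' x n])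
  have V: "\<bar>V\<bar> \<le> W + 1 / 2 * B"
    unfolding V_def W_def B_def by (rule genuine_BD_voronovskaja[OF f f' cont x n])
  \<comment> \<open>Thus the coefficient \<open>5 * sqrt 6 / 12\<close> is at least 1, and the other
    nonnegative terms are slack.\<close>
  have "12 / 5 \<le> sqrt 6" by (rule real_le_rsqrt) (simp add: power2_eq_square)
  then have "W \<le> 5 * sqrt 6 / 12 * W" using mult_right_mono[of 1 "5 * sqrt 6 / 12" W] W0 by simp
  with V have V': "\<bar>V\<bar> \<le> 5 * sqrt 6 / 12 * W + 13 / 32 * W2 + 9 / 8 * B"
    using W20 B0 by linarith
  \<comment> \<open>The limit replaces \<open>a1 n\<close> through \<open>(1 + a1 n) * D - (1 + L1)
    * f' x = (a1 n - L1) * D + (1 + L1) * (D - f' x)\<close>.\<close>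
  have "real n * (mod_genuine_BD a0 a1 n f x - f x) - x * (1 - x) * f'' x
      - (1 - 2 * x) / 2 * (1 + L1) * f' x
    = V + 1 / 2 * ((1 - 2 * x) * (a1 n - L1) * D + (1 + L1) * ((1 - 2 * x) * (D - f' x)))"
    using mod_genuine_BD_decomp[of a0 n a1, OF assms(1)[OF n] n f contf', of x]
    by (simp add: V_def D_def field_simps)
  moreover have "\<bar>(1 - 2 * x) * (a1 n - L1) * D\<bar> \<le> \<bar>L1 - a1 n\<bar> * S"
  proof -
    have "\<bar>1 - 2 * x\<bar> * \<bar>D\<bar> \<le> 1 * S" using x S by (intro mult_mono) auto
    then have "\<bar>L1 - a1 n\<bar> * (\<bar>1 - 2 * x\<bar> * \<bar>D\<bar>) \<le> \<bar>L1 - a1 n\<bar> * S"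
      by (intro mult_left_mono) auto
    then show ?thesis by (simp add: abs_mult abs_minus_commute mult_ac)
  qed
  moreover have "\<bar>(1 + L1) * ((1 - 2 * x) * (D - f' x))\<bar> \<le> \<bar>1 + L1\<bar> * E"
    using E by (simp add: abs_mult mult_left_mono)
  ultimately show ?thesis
    using V' unfolding S_def[symmetric] E_def[symmetric] W_def[symmetric] W2_def[symmetric] B_def[symmetric]
    by (simp only:) (simp only: abs_le_iff distrib_left, linarith)
qed

end
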